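(* Let $(\hat\pi_k)$ be a sequence of probability measures on $\mathbb{N}_0$ with $\sum_{j\ge0}j\hat\pi_k(j)=1$ for all $k$, and let $(h_k)$, $(\tau_k)$ be positive sequences converging to zero. Define $$\breve\Psi_k(q)=\frac{\hat\Psi_k(h_kq)}{\tau_kh_k},\quad \hat\Psi_k(q)=\sum_{j\ge2}\big((1-q)^j-1+jq\big)\hat\pi_k(j),\qquad \breve\mu_k=\frac1{\tau_k}\sum_{j\ge2}(j-1)\hat\pi_k(j)\,\delta_{jh_k}.$$ (i) Suppose that $(\breve\mu_k)$ Lévy-converges to some finite measure $\kappa$ on $[0,\infty]$ as $k\to\infty$. Then for each $q\in[0,\infty)$, as $k\to\infty$, $$\breve\Psi_k(q)\to\Psi(q):=\tfrac12\alpha_0q^2+\alpha_\infty q+\int_{(0,\infty)}\frac{e^{-qx}-1+qx}{x}\,d\mu(x),$$ where $(\alpha_0,\alpha_\infty,\mu)$ is the Lévy triple associated with $\kappa$ by $$d\kappa(x)=\alpha_0\,d\delta_0+\alpha_\infty\,d\delta_\infty+(x\wedge1)\,d\mu(x).$$ Moreover, for each $m\in\mathbb{N}$ the derivative $\breve\Psi_k^{(m)}$ converges to $\Psi^{(m)}$ locally uniformly in $(0,\infty)$. (ii) Conversely, suppose $\Psi(q)=\lim_{k\to\infty}\breve\Psi_k(q)$ exists for each $q\in[0,\infty)$. Then $(\breve\mu_k)$ Lévy-converges to some finite measure $\kappa$ on $[0,\infty]$, and $\Psi$ is given by the formula in (i) with $(\alpha_0,\alpha_\infty,\mu)$ the Lévy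 triple associated with $\kappa$.
   Context: $\mathbb{N}_0=\{0,1,2,\dots\}$; $\delta_x$ is the Dirac mass at $x$; $x\wedge 1=\min(x,1)$. The function $\breve\Psi_k$ is guaranteed to be defined on $[0,2/h_k]$, so for fixed $q$ it is defined for all large $k$. Lévy-convergence: $(\breve\mu_k)$ Lévy-converges to a finite measure $\kappa$ on $[0,\infty]$ if $(x\wedge1)\,d\breve\mu_k(x)\to d\kappa(x)$ weak-$\star$ on $[0,\infty]$, i.e. when tested against every $g\in C([0,\infty])$. A Lévy triple is $(\alpha_0,\alpha_\infty,\mu)$ with $\alpha_0,\alpha_\infty\ge 0$ and $\mu$ a nonnegative measure on $(0,\infty)$ with $\int_{(0,\infty)}(x\wedge 1)\,d\mu(x)<\infty$. *)

theory Defs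
  imports "HOL-Probability.Probability"
begin

definition Psi_hat :: "nat pmf \<Rightarrow> real \<Rightarrow> real" where
  "Psi_hat p q = (\<Sum>\<^sub>\<infinity>j\<in>{2..}. ((1 - q) ^ j - 1 + real j * q) * pmf p j)"

text \<open>
  The series defining \<open>Psi_hat\<close> converges for \<open>0 \<le> q \<le> 2\<close> if \<open>p\<close> has finite mean;
  hence \<open>Psi_breve p h \<tau>\<close> is only meaningful on \<open>[0, 2/h]\<close>.
\<close>

definition Psi_breve :: "nat pmf \<Rightarrow> real \<Rightarrow> real \<Rightarrow> real \<Rightarrow> real" where
  "Psi_breve p h \<tau> q = Psi_hat p (h * q) / (\<tau> * h)"

text \<open>
  The weighted sum of Dirac masses, built as the image under \<open>j \<mapsto> j h\<close> of the measure on
  \<open>{2, 3, \<dots>}\<close> with the given weights (see \<open>emeasure_mu_breve\<close>).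
\<close>

definition mu_breve :: "nat pmf \<Rightarrow> real \<Rightarrow> real \<Rightarrow> real measure" where
  "mu_breve p h \<tau> =
     distr (density (count_space {2..}) (\<lambda>j. ennreal (1 / \<tau> * ((real j - 1) * pmf p j))))
       (restrict_space borel {0<..}) (\<lambda>j. real j * h)"

lemma emeasure_mu_breve:
  assumes "h > 0" "A \<in> sets (restrict_space borel {0<..})"
  shows "emeasure (mu_breve p h \<tau>) A =
    (\<integral>\<^sup>+ j. ennreal (1 / \<tau> * ((real j - 1) * pmf p j)) *
       emeasure (return (restrict_space borel {0<..}) (real j * h)) A \<partial>count_space {2..})"
proof -
  have m: "(\<lambda>j. real j * h) \<in> count_space {2..} \<rightarrow>\<^sub>M restrict_space borel {0<..}"
    using assms(1) by (auto simp: space_restrict_space)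
  show ?thesis
    unfolding mu_breve_def using assms m
    by (auto simp: emeasure_distr emeasure_density space_restrict_space sets_restrict_space
        indicator_def intro!: nn_integral_cong)
qed

text \<open>
  The measure \<open>(x \<and> 1) d\<mu>(x)\<close> for a measure \<open>\<mu>\<close> on \<open>(0,\<infinity>)\<close>, regarded as a measure on
  \<open>[0,\<infinity>]\<close>, which is the type \<^typ>\<open>ennreal\<close> with its compact order topology.
\<close>

definition truncated_measure :: "real measure \<Rightarrow> ennreal measure" where
  "truncated_measure \<mu> = distr (density \<mu> (\<lambda>x. ennreal (min x 1))) borel ennreal"

definition weak_star_conv :: "(nat \<Rightarrow> ennreal measure) \<Rightarrow> ennreal measure \<Rightarrow> bool" where
  "weak_star_conv M N \<longleftrightarrow>
     (\<forall>g :: ennreal \<Rightarrow> real. continuous_on UNIV g \<longrightarrow>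
        (\<lambda>k. \<integral>x. g x \<partial>M k) \<longlonglongrightarrow> (\<integral>x. g x \<partial>N))"

definition Levy_converges :: "(nat \<Rightarrow> real measure) \<Rightarrow> ennreal measure \<Rightarrow> bool" where
  "Levy_converges \<mu> \<kappa> \<longleftrightarrow> weak_star_conv (\<lambda>k. truncated_measure (\<mu> k)) \<kappa>"

definition Levy_triple :: "real \<Rightarrow> real \<Rightarrow> real measure \<Rightarrow> bool" where
  "Levy_triple \<alpha>\<^sub>0 \<alpha>\<^sub>i\<^sub>n\<^sub>f \<mu> \<longleftrightarrow>
     \<alpha>\<^sub>0 \<ge> 0 \<and> \<alpha>\<^sub>i\<^sub>n\<^sub>f \<ge> 0 \<and> sets \<mu> = sets (restrict_space borel {0<..}) \<and>
     (\<integral>\<^sup>+ x. ennreal (min x 1) \<partial>\<mu>) < \<infinity>"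

definition Levy_triple_of :: "ennreal measure \<Rightarrow> real \<Rightarrow> real \<Rightarrow> real measure \<Rightarrow> bool" where
  "Levy_triple_of \<kappa> \<alpha>\<^sub>0 \<alpha>\<^sub>i\<^sub>n\<^sub>f \<mu> \<longleftrightarrow>
     Levy_triple \<alpha>\<^sub>0 \<alpha>\<^sub>i\<^sub>n\<^sub>f \<mu> \<and>
     (\<forall>A\<in>sets borel. emeasure \<kappa> A =
        ennreal \<alpha>\<^sub>0 * emeasure (return borel 0) A +
        ennreal \<alpha>\<^sub>i\<^sub>n\<^sub>f * emeasure (return borel \<infinity>) A +
        emeasure (truncated_measure \<mu>) A)"

definition Levy_Psi :: "real \<Rightarrow> real \<Rightarrow> real measure \<Rightarrow> real \<Rightarrow> real" where
  "Levy_Psi \<alpha>\<^sub>0 \<alpha>\<^sub>i\<^sub>n\<^sub>f \<mu> q =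
     1 / 2 * \<alpha>\<^sub>0 * q\<^sup>2 + \<alpha>\<^sub>i\<^sub>n\<^sub>f * q + (\<integral>x. (exp (- q * x) - 1 + q * x) / x \<partial>\<mu>)"

text \<open>
  Since \<^const>\<open>deriv\<close> is total, existence of the iterated derivatives is expressed separately.
\<close>

definition times_differentiable_on :: "nat \<Rightarrow> (real \<Rightarrow> real) \<Rightarrow> real set \<Rightarrow> bool" where
  "times_differentiable_on m f S \<longleftrightarrow> (\<forall>n<m. \<forall>x\<in>S. ((deriv ^^ n) f) differentiable (at x))"

end

theory Submission
  imports Defs "HOL-Real_Asymp.Real_Asymp"
begin

text \<open>
  Put \<open>x = j h\<close>. The term of index \<open>j\<close> in \<open>Psi_breve\<close> equals the mass that \<open>mu_breve\<close>
  puts at \<open>x\<close> times \<open>((1 - hq)^(x/h) - 1 + qx) / (x - h)\<close>, and as \<open>h\<close> tends to \<open>0\<close> this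
  kernel tends to the Levy kernel \<open>(exp (-qx) - 1 + qx) / x\<close>. The error is small relative to
  \<open>min x 1\<close>, uniformly over all lattice points (\<open>binomial_kernel_close\<close>). Dividing by
  \<open>min x 1\<close> turns the Levy kernel into a function \<open>levy_test q\<close> that is continuous on the
  compact space \<open>[0,\<infinity>]\<close>, with the values \<open>q^2/2\<close> at \<open>0\<close> and \<open>q\<close> at \<open>\<infinity>\<close>. Hence, as long as
  the truncated measures have bounded mass, \<open>Psi_breve\<close> at \<open>q\<close> differs from the integral of
  \<open>levy_test q\<close> against the truncated measure by an error that tends to \<open>0\<close>.
  
  If the measures Levy-converge to \<open>\<kappa>\<close>, their masses converge, so \<open>Psi_breve\<close> converges at \<open>q\<close>
  to the integral of \<open>levy_test q\<close> against \<open>\<kappa>\<close>. Splitting \<open>\<kappa>\<close> into its atoms at \<open>0\<close> and \<open>\<infinity>\<close> and the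
  rest gives \<open>Levy_Psi\<close> (\<open>integral_levy_test\<close>), and the same splitting determines the
  Levy triple. For the derivatives, \<open>Psi_breve\<close> on \<open>(0, 1/h)\<close> has derivatives of alternating
  sign from the second on. So every derivative is convex up to a sign, and for convex
  functions pointwise convergence to a smooth limit passes to the derivatives, which
  even converge locally uniformly because they are monotone (\<open>derivatives_converge\<close>).
  
  Conversely, suppose that \<open>Psi_breve\<close> converges pointwise. As \<open>levy_test 1\<close> is bounded below
  by a positive constant, convergence at \<open>q = 1\<close> bounds the masses, and then the
  integrals of all \<open>levy_test q\<close> converge. The second difference of \<open>levy_test q\<close> in \<open>q\<close>, at
  integers \<open>n\<close>, is \<open>exp (-nx)\<close> times a fixed function that vanishes only at \<open>\<infinity>\<close>. By
  Weierstrass approximation in the variable \<open>exp (-x)\<close> these functions, together with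
  \<open>levy_test 1\<close>, span a dense subspace of \<open>C([0,\<infinity>])\<close>, so the integrals of every continuous
  function converge (\<open>levy_tests_determine_limit\<close>). Helly's selection theorem provides
  a measure that represents these limits (\<open>weak_star_limit_exists\<close>).
\<close>

section \<open>Continuous functions on the compactified half-line\<close>

lemma compact_UNIV_ennreal: "compact (UNIV :: ennreal set)"
proof -
  have "seq_compact (UNIV :: ennreal set)"
    unfolding seq_compact_def using compact_complete_linorder by fastforce
  then show ?thesis
    by (metis seq_compact_imp_countably_compact countably_compact_eq_compact)
qed

lemma bounded_continuous_ennreal:
  fixes g :: "ennreal \<Rightarrow> real"
  assumes "continuous_on UNIV g"
  obtains B where "B > 0" "\<And>x. \<bar>g x\<bar> \<le> B"
proof -
  have "bounded (range g)"
    using assms compact_UNIV_ennreal compact_continuous_image compact_imp_bounded by blast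
  then obtain B where B: "\<And>x. \<bar>g x\<bar> \<le> B"
    by (auto simp: bounded_iff)
  then show ?thesis
    using order_trans[OF B, of "\<bar>B\<bar> + 1"] by (intro that[of "\<bar>B\<bar> + 1"]) auto
qed

text \<open>
  All test functions are given by a formula on \<open>(0,\<infinity>)\<close> and by their limits at the two
  ends.
\<close>

definition extend_ennreal :: "real \<Rightarrow> real \<Rightarrow> (real \<Rightarrow> real) \<Rightarrow> ennreal \<Rightarrow> real" where
  "extend_ennreal a b f x = (if x = 0 then a else if x = top then b else f (enn2real x))"

lemma extend_ennreal_simps [simp]:
  "extend_ennreal a b f 0 = a" "extend_ennreal a b f top = b"
  "x > 0 \<Longrightarrow> extend_ennreal a b f (ennreal x) = f x"
  by (auto simp: extend_ennreal_def)

lemma ennreal_exhaust_three: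
  fixes x :: ennreal
  obtains "x = 0" | r where "r > 0" "x = ennreal r" | "x = top"
  by (cases x) (metis ennreal_0 less_eq_real_def, simp)

text \<open>
  This reduces continuity on \<open>[0,\<infinity>]\<close> to two limits of real functions.
\<close>

lemma continuous_on_extend_ennreal:
  assumes f: "continuous_on {0<..} f"
    and a: "(f \<longlongrightarrow> a) (at_right 0)" and b: "(f \<longlongrightarrow> b) at_top"
  shows "continuous_on UNIV (extend_ennreal a b f)"
proof -
  let ?g = "extend_ennreal a b f"
  have "(?g \<longlongrightarrow> ?g c) (nhds c)" for c
  proof (cases c rule: ennreal_exhaust_three)
    case 1
    show ?thesis
    proof (rule tendstoI)
      fix e :: real assume "e > 0"
      then have "eventually (\<lambda>x. dist (f x) a < e) (at_right 0)"
        using a by (rule tendstoD[rotated])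
      then obtain d where d: "d > 0" "\<And>x. 0 < x \<Longrightarrow> x < d \<Longrightarrow> dist (f x) a < e"
        by (auto simp: eventually_at_right_field)
      have "eventually (\<lambda>x. x < ennreal d) (nhds c)"
        using d(1) 1 by (intro eventually_nhds_in_open[of "{..<ennreal d}" c, simplified]) auto
      then show "eventually (\<lambda>x. dist (?g x) (?g c) < e) (nhds c)"
      proof eventually_elim
        case (elim x)
        then show ?case using d \<open>e > 0\<close> 1
          by (cases x rule: ennreal_exhaust_three) (auto simp: ennreal_less_iff)
      qed
    qed
  next
    case 3
    show ?thesis
    proof (rule tendstoI)
      fix e :: real assume "e > 0"
      then have "eventually (\<lambda>x. dist (f x) b < e) at_top"
        using b by (rule tendstoD[rotated])
      then obtain N where N: "\<And>x. N \<le> x \<Longrightarrow> dist (f x) b < e"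
        by (auto simp: eventually_at_top_linorder)
      have "eventually (\<lambda>x. ennreal (max N 1) < x) (nhds c)"
        using 3 by (intro eventually_nhds_in_open[of "{ennreal (max N 1)<..}" c, simplified]) auto
      then show "eventually (\<lambda>x. dist (?g x) (?g c) < e) (nhds c)"
      proof eventually_elim
        case (elim x)
        then show ?case using N \<open>e > 0\<close> 3
          by (cases x rule: ennreal_exhaust_three) (auto simp: ennreal_less_iff)
      qed
    qed
  next
    case (2 r)
    have "isCont f r"
      using f 2 by (simp add: continuous_on_eq_continuous_at)
    moreover have "(enn2real \<longlongrightarrow> r) (nhds c)"
      using 2 by (intro tendsto_enn2real) (auto simp: filterlim_ident)
    ultimately have "((\<lambda>x. f (enn2real x)) \<longlongrightarrow> f r) (nhds c)"
      by (rule isCont_tendsto_compose)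
    moreover have "eventually (\<lambda>x. f (enn2real x) = ?g x) (nhds c)"
    proof -
      have "eventually (\<lambda>x. x \<in> {0<..<top}) (nhds c)"
        using 2 by (intro eventually_nhds_in_open) auto
      then show ?thesis
        by eventually_elim (auto simp: extend_ennreal_def)
    qed
    ultimately show ?thesis
      using 2 by (auto intro: Lim_transform_eventually)
  qed
  then show ?thesis
    by (auto simp: continuous_on_def intro: tendsto_mono[OF at_within_le_nhds])
qed

section \<open>The Levy kernel and its lattice approximation\<close>

definition levy_kernel :: "real \<Rightarrow> real \<Rightarrow> real" where
  "levy_kernel q x = (exp (- q * x) - 1 + q * x) / x"

text \<open>
  The integrand of \<open>Levy_Psi\<close> relative to the finite measure \<open>min x 1 d\<mu>\<close>. The end values
  reproduce the terms \<open>\<alpha>\<^sub>0 q\<^sup>2 / 2\<close> and \<open>\<alpha>\<^sub>i\<^sub>n\<^sub>f q\<close>, so that \<open>Levy_Psi\<close> is one single integral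
  against \<open>\<kappa>\<close>.
\<close>

definition levy_test :: "real \<Rightarrow> ennreal \<Rightarrow> real" where
  "levy_test q = extend_ennreal (q\<^sup>2 / 2) q (\<lambda>x. levy_kernel q x / min x 1)"

lemma levy_test_simps [simp]:
  "levy_test q 0 = q\<^sup>2 / 2" "levy_test q top = q"
  "x > 0 \<Longrightarrow> levy_test q (ennreal x) = levy_kernel q x / min x 1"
  by (auto simp: levy_test_def)

lemma levy_kernel_at_0:
  assumes "q > 0"
  shows "((\<lambda>x. levy_kernel q x / x) \<longlongrightarrow> q\<^sup>2 / 2) (at_right 0)"
  unfolding levy_kernel_def power2_eq_square using assms by real_asymp

lemma levy_kernel_at_top:
  assumes "q > 0"
  shows "(levy_kernel q \<longlongrightarrow> q) at_top"
  unfolding levy_kernel_def using assms by real_asymp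

text \<open>
  The truncation \<open>min x 1\<close> behaves like \<open>x\<close> near \<open>0\<close> and like \<open>1\<close> near \<open>\<infinity>\<close>.
\<close>

lemma tendsto_min_1:
  assumes "((\<lambda>x::real. f x / x) \<longlongrightarrow> a) (at_right 0)" "(f \<longlongrightarrow> b) at_top"
  shows "((\<lambda>x. f x / min x 1) \<longlongrightarrow> a) (at_right 0)" "((\<lambda>x. f x / min x 1) \<longlongrightarrow> b) at_top"
proof -
  have "eventually (\<lambda>x::real. x < 1) (at_right 0)"
    by (simp add: eventually_at_right_less eventually_at_right_field exI[of _ 1])
  then have "eventually (\<lambda>x. f x / x = f x / min x 1) (at_right 0)"
    by eventually_elim auto
  from Lim_transform_eventually[OF assms(1) this]
  show "((\<lambda>x. f x / min x 1) \<longlongrightarrow> a) (at_right 0)" .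
  have "eventually (\<lambda>x. f x = f x / min x 1) at_top"
    using eventually_ge_at_top[of 1] by eventually_elim auto
  from Lim_transform_eventually[OF assms(2) this]
  show "((\<lambda>x. f x / min x 1) \<longlongrightarrow> b) at_top" .
qed

lemma continuous_on_levy_test:
  assumes "q \<ge> 0"
  shows "continuous_on UNIV (levy_test q)"
proof (cases "q = 0")
  case True
  then have "levy_test q = (\<lambda>_. 0)"
    by (auto simp: levy_test_def extend_ennreal_def levy_kernel_def fun_eq_iff)
  then show ?thesis by simp
next
  case False
  with assms have q: "q > 0" by simp
  have "continuous_on {0<..} (\<lambda>x. levy_kernel q x / min x 1)"
    unfolding levy_kernel_def by (intro continuous_intros) auto
  with tendsto_min_1[OF levy_kernel_at_0[OF q] levy_kernel_at_top[OF q]] show ?thesis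
    unfolding levy_test_def by (intro continuous_on_extend_ennreal)
qed

lemma levy_test_pos:
  assumes "q > 0" shows "levy_test q x > 0"
proof (cases x rule: ennreal_exhaust_three)
  case (2 r)
  have "1 + (- q * r) < exp (- q * r)"
    using 2 assms by (simp add: exp_minus_greater)
  then show ?thesis using 2 by (auto simp: levy_kernel_def)
qed (use assms in auto)

text \<open>
  The term of index \<open>j\<close> in \<open>Psi_breve\<close> per unit of mass of \<open>mu_breve\<close> at \<open>j h\<close>. The
  denominator is \<open>(j - 1) h\<close> because the mass carries the factor \<open>j - 1\<close>.
\<close>

definition binomial_kernel :: "real \<Rightarrow> real \<Rightarrow> nat \<Rightarrow> real" where
  "binomial_kernel h q j = ((1 - h * q) ^ j - 1 + real j * (h * q)) / ((real j - 1) * h)"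

text \<open>
  Near \<open>x = 0\<close> an error bound proportional to \<open>h\<close> would be useless, since at \<open>x = 2 h\<close> it
  has to be small compared with \<open>h\<close> itself. The binomial expansion truncated after the
  quadratic term has an error of order \<open>x\<^sup>2\<close> after division by \<open>(j - 1) h\<close>, and this is small
  compared with \<open>x\<close>. The bound follows by induction because \<open>d\<close> grows in each step by \<open>y\<close>
  times the linear remainder, which is nonnegative and at most its quadratic
  approximation.
\<close>

lemma power_one_minus_cubic:
  fixes y :: real
  assumes "0 \<le> y" "y \<le> 1"
  defines "d \<equiv> \<lambda>j. real j * (real j - 1) / 2 * y\<^sup>2 - ((1 - y) ^ j - 1 + real j * y)"
  shows "0 \<le> d j" "d j \<le> real j * (real j - 1) * (real j - 2) / 6 * y ^ 3"
proof -
  have lin: "0 \<le> (1 - y) ^ j - 1 + real j * y" for j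
    using Bernoulli_inequality[of "-y" j] assms by simp
  have step: "d (Suc j) = d j + y * ((1 - y) ^ j - 1 + real j * y)" for j
    by (simp add: d_def field_simps power2_eq_square)
  show pos: "0 \<le> d j" for j
  proof (induction j)
    case (Suc j)
    then show ?case
      unfolding step using lin[of j] assms(1) by (metis Suc add_nonneg_nonneg mult_nonneg_nonneg)
  qed (simp add: d_def)
  show "d j \<le> real j * (real j - 1) * (real j - 2) / 6 * y ^ 3" for j
  proof (induction j)
    case (Suc j)
    have "y * ((1 - y) ^ j - 1 + real j * y) \<le> y * (real j * (real j - 1) / 2 * y\<^sup>2)"
      using pos[of j] assms by (intro mult_left_mono) (auto simp: d_def)
    with Suc show ?case
      unfolding step by (simp add: algebra_simps power2_eq_square power3_eq_cube)
  qed (simp add: d_def)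
qed

text \<open>
  Telescoping \<open>a ^ j - (1 - y) ^ j\<close> with \<open>a = exp (- y)\<close> gives \<open>j\<close> terms of size at
  most \<open>y\<^sup>2 a ^ (j - 1)\<close>, and \<open>j y a ^ j = t exp (- t) \<le> 1\<close> for \<open>t = j y\<close>. This makes the bound
  uniform in \<open>j\<close>.
\<close>

lemma power_one_minus_exp:
  fixes y :: real
  assumes "0 \<le> y" "y \<le> 1"
  shows "\<bar>(1 - y) ^ j - exp (- y * real j)\<bar> \<le> 3 * y"
proof (cases j)
  case 0
  then show ?thesis using assms by simp
next
  case (Suc n)
  define a where "a = exp (- y)"
  have le: "1 - y \<le> a" using exp_minus_ge[of y] by (simp add: a_def)
  have "exp (-y) * (1 + y) \<le> exp (-y) * exp y"
    by (intro mult_left_mono) auto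
  also have "\<dots> = 1" by (simp flip: exp_add)
  finally have "a * (1 + y) \<le> 1" by (simp add: a_def)
  also have "1 \<le> (1 - y + y\<^sup>2) * (1 + y)"
    using assms by (simp add: algebra_simps power2_eq_square)
  finally have gap: "a - (1 - y) \<le> y\<^sup>2"
    using assms by (simp add: mult_le_cancel_right)
  have tele: "a ^ Suc n - (1 - y) ^ Suc n \<le> real (Suc n) * (a - (1 - y)) * a ^ n" for n
  proof (induction n)
    case (Suc n)
    have "(a - (1 - y)) * (1 - y) ^ Suc n \<le> (a - (1 - y)) * a ^ Suc n"
      using le assms by (intro mult_left_mono power_mono) auto
    moreover have "a * (a ^ Suc n - (1 - y) ^ Suc n) \<le> a * (real (Suc n) * (a - (1 - y)) * a ^ n)"
      using Suc by (intro mult_left_mono) (auto simp: a_def)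
    ultimately show ?case by (simp add: algebra_simps)
  qed simp
  have exp_j: "exp (- y * real j) = a ^ j"
    by (simp add: a_def mult.commute flip: exp_of_nat_mult)
  have "real j * y \<le> exp (real j * y)"
    using exp_ge_add_one_self[of "real j * y"] by linarith
  then have te: "real j * y * a ^ j \<le> 1"
    unfolding exp_j[symmetric] by (simp add: exp_minus field_simps)
  have "a ^ j - (1 - y) ^ j \<le> real j * (a - (1 - y)) * a ^ n"
    using tele[of n] Suc by simp
  also have "\<dots> \<le> real j * y\<^sup>2 * a ^ n"
    using gap by (intro mult_right_mono mult_left_mono) (auto simp: a_def)
  also have "\<dots> = y * exp y * (real j * y * a ^ j)"
    by (simp add: Suc a_def power2_eq_square exp_minus field_simps)
  also have "\<dots> \<le> y * exp y * 1"
    using te assms by (intro mult_left_mono) auto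
  also have "\<dots> \<le> y * 3 * 1"
    using assms exp_le order_trans[of "exp y" "exp 1" 3] by (intro mult_right_mono mult_left_mono) auto
  finally have "a ^ j - (1 - y) ^ j \<le> 3 * y" by simp
  moreover have "(1 - y) ^ j \<le> a ^ j"
    using le assms by (intro power_mono) auto
  ultimately show ?thesis unfolding exp_j by simp
qed

text \<open>
  Two regimes. For \<open>x = j h\<close> below a small \<open>d\<close> both kernels are within \<open>e x / 2\<close> of
  \<open>q\<^sup>2 x / 2\<close>. For \<open>x \<ge> d\<close> the replacement of \<open>(1 - h q) ^ j\<close> by \<open>exp (- q x)\<close> and that of
  \<open>x - h\<close> by \<open>x\<close> cost at most \<open>C h\<close>, where \<open>C\<close> depends only on \<open>q\<close> and \<open>d\<close>.
\<close>

lemma binomial_kernel_close: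
  assumes q: "q > 0" and e: "e > 0"
  shows "\<forall>\<^sub>F h in at_right 0. \<forall>j\<ge>2.
    \<bar>binomial_kernel h q j - levy_kernel q (real j * h)\<bar> \<le> e * min (real j * h) 1"
proof -
  have "\<forall>\<^sub>F x in at_right 0. dist (levy_kernel q x / x) (q\<^sup>2 / 2) < e / 2"
    using levy_kernel_at_0[OF q] e by (intro tendstoD) auto
  then obtain d0 where d0: "d0 > 0"
    "\<And>x. 0 < x \<Longrightarrow> x < d0 \<Longrightarrow> \<bar>levy_kernel q x / x - q\<^sup>2 / 2\<bar> < e / 2"
    by (auto simp: eventually_at_right_field dist_real_def)
  define d where "d = min d0 (min 1 (3 * e / q ^ 3))"
  have d: "0 < d" "d \<le> d0" "d \<le> 1" "d \<le> 3 * e / q ^ 3"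
    using q e d0(1) by (auto simp: d_def)
  have qd: "q ^ 3 * d \<le> 3 * e"
    using d(4) q by (simp add: field_simps)
  define C where "C = 2 * (3 * q) / d + 2 * q / d"
  have "C > 0" using q d by (simp add: C_def)
  have ev: "\<forall>\<^sub>F h in at_right 0. 0 < h \<and> h * q \<le> 1 \<and> h * C \<le> e * d"
  proof -
    have "\<forall>\<^sub>F h in at_right 0. h < Min {1 / q, e * d / C}"
      using q e d \<open>C > 0\<close> by (intro eventually_at_right_less eventually_at_rightI[of 0 "Min {1 / q, e * d / C}"]) auto
    then show ?thesis
      using eventually_at_right_less[of 0]
      by eventually_elim (use q e d \<open>C > 0\<close> in \<open>auto simp: field_simps\<close>)
  qed
  then show ?thesis
  proof eventually_elim
    case (elim h)
    show ?case
    proof (intro allI impI)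
      fix j :: nat assume "j \<ge> 2"
      define x where "x = real j * h"
      have x: "x > 0" "2 * h \<le> x" using \<open>j \<ge> 2\<close> elim by (auto simp: x_def)
      have den: "(real j - 1) * h = x - h" "x - h \<ge> x / 2" "x - h > 0"
        using x elim by (auto simp: x_def left_diff_distrib)
      have y: "0 \<le> h * q" "h * q \<le> 1" using elim q by auto
      show "\<bar>binomial_kernel h q j - levy_kernel q (real j * h)\<bar> \<le> e * min (real j * h) 1"
      proof (cases "x < d")
        case True
        have lk: "\<bar>levy_kernel q x - q\<^sup>2 / 2 * x\<bar> \<le> e / 2 * x"
        proof -
          have "levy_kernel q x - q\<^sup>2 / 2 * x = (levy_kernel q x / x - q\<^sup>2 / 2) * x"
            using x by (simp add: field_simps)
          then show ?thesis using d0(2)[of x] x True d by (simp add: abs_mult)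
        qed
        define a where "a = (1 - h * q) ^ j - 1 + real j * (h * q)"
        note cub = power_one_minus_cubic[OF y, of j, folded a_def]
        have "q\<^sup>2 / 2 * x - binomial_kernel h q j
            = (real j * (real j - 1) / 2 * (h * q)\<^sup>2 - a) / ((real j - 1) * h)"
          unfolding binomial_kernel_def a_def[symmetric] x_def
          using \<open>j \<ge> 2\<close> elim by (simp add: field_simps power2_eq_square)
        moreover have "\<dots> \<le> (real j * (real j - 1) * real j / 6 * (h * q) ^ 3) / ((real j - 1) * h)"
        proof (rule divide_right_mono)
          have "real j * (real j - 1) * (real j - 2) / 6 * (h * q) ^ 3
              \<le> real j * (real j - 1) * real j / 6 * (h * q) ^ 3"
            using \<open>j \<ge> 2\<close> y by (intro mult_right_mono divide_right_mono mult_left_mono) auto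
          with cub(2) show "real j * (real j - 1) / 2 * (h * q)\<^sup>2 - a
              \<le> real j * (real j - 1) * real j / 6 * (h * q) ^ 3" by linarith
          show "0 \<le> (real j - 1) * h" using den by simp
        qed
        moreover have "\<dots> = q ^ 3 * x / 6 * x"
          using \<open>j \<ge> 2\<close> elim by (simp add: x_def field_simps power3_eq_cube)
        moreover have "\<dots> \<le> e / 2 * x"
        proof (rule mult_right_mono)
          have "q ^ 3 * x \<le> q ^ 3 * d" using True q by (intro mult_left_mono) auto
          then show "q ^ 3 * x / 6 \<le> e / 2" using qd by linarith
        qed (use x in simp)
        moreover have "0 \<le> (real j * (real j - 1) / 2 * (h * q)\<^sup>2 - a) / ((real j - 1) * h)"
          using cub(1) den by (intro divide_nonneg_nonneg) auto
        ultimately have "\<bar>binomial_kernel h q j - q\<^sup>2 / 2 * x\<bar> \<le> e / 2 * x"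
          by linarith
        with lk have "\<bar>binomial_kernel h q j - levy_kernel q x\<bar> \<le> e * x"
          by linarith
        then show ?thesis using True d by (simp add: x_def)
      next
        case False
        define p where "p = (1 - h * q) ^ j"
        define E where "E = exp (- q * x)"
        have "E = exp (- (h * q) * real j)" by (simp add: x_def E_def mult_ac)
        with power_one_minus_exp[OF y, of j] have pE: "\<bar>p - E\<bar> \<le> 3 * (h * q)"
          by (simp only: p_def)
        have bk: "binomial_kernel h q j = (p - 1 + q * x) / (x - h)"
          unfolding binomial_kernel_def den(1) by (simp add: p_def x_def mult_ac)
        have "binomial_kernel h q j - levy_kernel q x
            = (p - E) / (x - h) + (E - 1 + q * x) / x * (h / (x - h))"
        proof -
          have inv: "1 / (x - h) - 1 / x = 1 / x * (h / (x - h))"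
            using den x by (simp add: field_simps)
          have "(p - 1 + q * x) * (1 / (x - h)) - (E - 1 + q * x) * (1 / x)
              = (p - E) * (1 / (x - h)) + (E - 1 + q * x) * (1 / (x - h) - 1 / x)"
            by (simp only: left_diff_distrib right_diff_distrib distrib_right)
          then show ?thesis
            unfolding bk levy_kernel_def E_def[symmetric] inv by simp
        qed
        moreover have "\<bar>(p - E) / (x - h)\<bar> \<le> 3 * (h * q) / (d / 2)"
          unfolding abs_divide using pE den d False by (intro frac_le) auto
        moreover have "\<bar>(E - 1 + q * x) / x * (h / (x - h))\<bar> \<le> q * (h / (d / 2))"
        proof -
          have "0 \<le> E - 1 + q * x" using exp_minus_ge[of "q * x"] by (simp add: E_def)
          moreover have "E \<le> 1" using q x by (simp add: E_def)
          ultimately have A: "0 \<le> (E - 1 + q * x) / x" "(E - 1 + q * x) / x \<le> q"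
            using x by (auto simp: field_simps)
          have B: "0 \<le> h / (x - h)" using den elim by simp
          have "h / (x - h) \<le> h / (d / 2)"
            using den d False elim by (intro frac_le) auto
          then have "(E - 1 + q * x) / x * (h / (x - h)) \<le> q * (h / (d / 2))"
            using A B q by (intro mult_mono) auto
          then show ?thesis
            using abs_of_nonneg[OF mult_nonneg_nonneg[OF A(1) B]] by simp
        qed
        moreover have "3 * (h * q) / (d / 2) + q * (h / (d / 2)) = h * C"
          using d by (simp add: C_def field_simps)
        ultimately have "\<bar>binomial_kernel h q j - levy_kernel q x\<bar> \<le> e * d"
          using elim by linarith
        also have "\<dots> \<le> e * min x 1"
          using e d False by (intro mult_left_mono) auto
        finally show ?thesis by (simp add: x_def)
      qed
    qed
  qed
qed

section \<open>Integrals against the lattice measures\<close>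

lemma truncated_measure_integral:
  fixes g :: "ennreal \<Rightarrow> real"
  assumes sets: "sets \<mu> = sets (restrict_space borel {0<..})" and g: "g \<in> borel_measurable borel"
  shows "integral\<^sup>L (truncated_measure \<mu>) g = (\<integral>x. min x 1 * g (ennreal x) \<partial>\<mu>)"
    and "integrable (truncated_measure \<mu>) g \<longleftrightarrow> integrable \<mu> (\<lambda>x. min x 1 * g (ennreal x))"
proof -
  have sp: "space \<mu> = {0<..}"
    using sets_eq_imp_space_eq[OF sets] by (simp add: space_restrict_space)
  have id: "(\<lambda>x. x) \<in> borel_measurable \<mu>"
    using sets by (simp add: measurable_restrict_space1 cong: measurable_cong_sets)
  have [measurable]: "ennreal \<in> borel_measurable \<mu>" "(\<lambda>x. min x 1) \<in> borel_measurable \<mu>"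
    using id by measurable
  have [measurable]: "(\<lambda>x. g (ennreal x)) \<in> borel_measurable \<mu>"
    using g by measurable
  have "integral\<^sup>L (truncated_measure \<mu>) g = (\<integral>x. g (ennreal x) \<partial>density \<mu> (\<lambda>x. ennreal (min x 1)))"
    unfolding truncated_measure_def using g by (intro integral_distr) auto
  also have "\<dots> = (\<integral>x. min x 1 *\<^sub>R g (ennreal x) \<partial>\<mu>)"
    by (intro integral_density AE_I2) (auto simp: sp)
  finally show "integral\<^sup>L (truncated_measure \<mu>) g = (\<integral>x. min x 1 * g (ennreal x) \<partial>\<mu>)" by simp
  have "integrable (truncated_measure \<mu>) g \<longleftrightarrow> integrable (density \<mu> (\<lambda>x. ennreal (min x 1))) (\<lambda>x. g (ennreal x))"
    unfolding truncated_measure_def using g by (intro integrable_distr_eq) auto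
  also have "\<dots> \<longleftrightarrow> integrable \<mu> (\<lambda>x. min x 1 *\<^sub>R g (ennreal x))"
    by (intro integrable_density AE_I2) (auto simp: sp)
  finally show "integrable (truncated_measure \<mu>) g \<longleftrightarrow> integrable \<mu> (\<lambda>x. min x 1 * g (ennreal x))" by simp
qed

lemma sets_truncated_measure [simp, measurable_cong]: "sets (truncated_measure \<mu>) = sets borel"
  by (simp add: truncated_measure_def)

lemma sets_mu_breve [simp]: "sets (mu_breve p h \<tau>) = sets (restrict_space borel {0<..})"
  by (simp add: mu_breve_def)

text \<open>
  The mass of \<open>mu_breve p h \<tau>\<close> at \<open>j h\<close>.
\<close>

definition jump_weight :: "nat pmf \<Rightarrow> real \<Rightarrow> nat \<Rightarrow> real" where
  "jump_weight p \<tau> j = 1 / \<tau> * ((real j - 1) * pmf p j)"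

lemma mu_breve_integral:
  fixes f :: "real \<Rightarrow> real"
  assumes h: "h > 0" and \<tau>: "\<tau> > 0" and f: "f \<in> borel_measurable (restrict_space borel {0<..})"
  shows "integral\<^sup>L (mu_breve p h \<tau>) f = (\<integral>j. jump_weight p \<tau> j * f (real j * h) \<partial>count_space {2..})"
    and "integrable (mu_breve p h \<tau>) f \<longleftrightarrow>
           integrable (count_space {2..}) (\<lambda>j. jump_weight p \<tau> j * f (real j * h))"
proof -
  let ?D = "density (count_space {2..}) (\<lambda>j. ennreal (jump_weight p \<tau> j))"
  have mu: "mu_breve p h \<tau> = distr ?D (restrict_space borel {0<..}) (\<lambda>j. real j * h)"
    by (simp add: mu_breve_def jump_weight_def[abs_def])
  have meas: "(\<lambda>j. real j * h) \<in> ?D \<rightarrow>\<^sub>M restrict_space borel {0<..}"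
    using h by (auto simp: space_restrict_space)
  have w: "AE j in count_space {2..}. 0 \<le> jump_weight p \<tau> j"
    using \<tau> by (auto simp: jump_weight_def)
  have "integral\<^sup>L (mu_breve p h \<tau>) f = (\<integral>j. f (real j * h) \<partial>?D)"
    unfolding mu by (intro integral_distr meas f)
  also have "\<dots> = (\<integral>j. jump_weight p \<tau> j *\<^sub>R f (real j * h) \<partial>count_space {2..})"
    by (intro integral_density w) auto
  finally show "integral\<^sup>L (mu_breve p h \<tau>) f = (\<integral>j. jump_weight p \<tau> j * f (real j * h) \<partial>count_space {2..})"
    by simp
  have "integrable (mu_breve p h \<tau>) f \<longleftrightarrow> integrable ?D (\<lambda>j. f (real j * h))"
    unfolding mu by (intro integrable_distr_eq meas f)
  also have "\<dots> \<longleftrightarrow> integrable (count_space {2..}) (\<lambda>j. jump_weight p \<tau> j *\<^sub>R f (real j * h))"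
    by (intro integrable_density w) auto
  finally show "integrable (mu_breve p h \<tau>) f \<longleftrightarrow>
           integrable (count_space {2..}) (\<lambda>j. jump_weight p \<tau> j * f (real j * h))" by simp
qed

lemma mean_integrable:
  assumes mean: "(\<lambda>j. real j * pmf p j) sums 1"
  shows "integrable (count_space {2..}) (\<lambda>j. real j * pmf p j)"
proof -
  have "summable (\<lambda>j. norm (real j * pmf p j))"
    using mean by (simp add: sums_iff)
  then have "Infinite_Set_Sum.abs_summable_on (\<lambda>j. real j * pmf p j) UNIV"
    by (simp add: Infinite_Set_Sum.abs_summable_on_def integrable_count_space_nat_iff)
  then have "Infinite_Set_Sum.abs_summable_on (\<lambda>j. real j * pmf p j) {2..}"
    by (rule abs_summable_on_subset) auto
  then show ?thesis
    by (simp add: Infinite_Set_Sum.abs_summable_on_def)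
qed

text \<open>
  Since \<open>jump_weight p \<tau> j \<le> j pmf p j / \<tau>\<close>, the truncated measure has mass at most
  \<open>1 / \<tau>\<close>.
\<close>

lemma jump_mass_integrable:
  assumes mean: "(\<lambda>j. real j * pmf p j) sums 1" and h: "h > 0" and \<tau>: "\<tau> > 0"
  shows "integrable (count_space {2..}) (\<lambda>j. jump_weight p \<tau> j * min (real j * h) 1)"
proof -
  have "integrable (count_space {2..}) (\<lambda>j. 1 / \<tau> * (real j * pmf p j))"
    using mean_integrable[OF mean] by (intro integrable_mult_right)
  then show ?thesis
  proof (rule Bochner_Integration.integrable_bound)
    show "AE j in count_space {2..}. norm (jump_weight p \<tau> j * min (real j * h) 1)
        \<le> norm (1 / \<tau> * (real j * pmf p j))"
    proof (rule AE_I2)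
      fix j assume "j \<in> space (count_space {2::nat..})"
      then have j: "j \<ge> 2" by simp
      have "jump_weight p \<tau> j * min (real j * h) 1 \<le> jump_weight p \<tau> j * 1"
        using j \<tau> by (intro mult_left_mono) (auto simp: jump_weight_def)
      also have "\<dots> \<le> 1 / \<tau> * (real j * pmf p j)"
        using \<tau> by (auto simp: jump_weight_def intro!: divide_right_mono mult_right_mono)
      finally have "jump_weight p \<tau> j * min (real j * h) 1 \<le> 1 / \<tau> * (real j * pmf p j)" .
      moreover have "0 \<le> jump_weight p \<tau> j * min (real j * h) 1"
        using j h \<tau> by (auto simp: jump_weight_def)
      ultimately show "norm (jump_weight p \<tau> j * min (real j * h) 1)
        \<le> norm (1 / \<tau> * (real j * pmf p j))" using \<tau> by simp
    qed
  qed auto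
qed

lemma truncated_mu_breve_integral:
  fixes g :: "ennreal \<Rightarrow> real"
  assumes mean: "(\<lambda>j. real j * pmf p j) sums 1" and h: "h > 0" and \<tau>: "\<tau> > 0"
    and g: "continuous_on UNIV g"
  shows "integral\<^sup>L (truncated_measure (mu_breve p h \<tau>)) g
      = (\<integral>j. jump_weight p \<tau> j * min (real j * h) 1 * g (ennreal (real j * h)) \<partial>count_space {2..})"
    and "integrable (count_space {2..}) (\<lambda>j. jump_weight p \<tau> j * min (real j * h) 1 * g (ennreal (real j * h)))"
    and "integrable (truncated_measure (mu_breve p h \<tau>)) g"
proof -
  obtain B where B: "B > 0" "\<And>x. \<bar>g x\<bar> \<le> B"
    using bounded_continuous_ennreal[OF g] by blast
  have gm [measurable]: "g \<in> borel_measurable borel"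
    using g by (rule borel_measurable_continuous_onI)
  have id: "(\<lambda>x::real. x) \<in> borel_measurable (restrict_space borel {0<..})"
    by (intro measurable_restrict_space1) auto
  then have m: "(\<lambda>x. min x 1 * g (ennreal x)) \<in> borel_measurable (restrict_space borel {0<..})"
    by measurable
  show I: "integrable (count_space {2..}) (\<lambda>j. jump_weight p \<tau> j * min (real j * h) 1 * g (ennreal (real j * h)))"
  proof (rule Bochner_Integration.integrable_bound)
    show "integrable (count_space {2..}) (\<lambda>j. jump_weight p \<tau> j * min (real j * h) 1 * B)"
      using jump_mass_integrable[OF assms(1-3)] by (intro integrable_mult_left)
    show "AE j in count_space {2..}. norm (jump_weight p \<tau> j * min (real j * h) 1 * g (ennreal (real j * h)))
        \<le> norm (jump_weight p \<tau> j * min (real j * h) 1 * B)"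
      using B by (intro AE_I2) (auto simp: abs_mult intro!: mult_left_mono)
  qed auto
  show "integral\<^sup>L (truncated_measure (mu_breve p h \<tau>)) g
      = (\<integral>j. jump_weight p \<tau> j * min (real j * h) 1 * g (ennreal (real j * h)) \<partial>count_space {2..})"
    using truncated_measure_integral(1)[OF sets_mu_breve gm] mu_breve_integral(1)[OF h \<tau> m]
    by (simp add: mult.assoc)
  show "integrable (truncated_measure (mu_breve p h \<tau>)) g"
    using truncated_measure_integral(2)[OF sets_mu_breve gm] mu_breve_integral(2)[OF h \<tau> m] I
    by (simp add: mult.assoc)
qed

lemma binomial_term_eq:
  assumes "j \<ge> 2" "h > 0"
  shows "((1 - h * q) ^ j - 1 + real j * (h * q)) * pmf p j / (\<tau> * h)
    = jump_weight p \<tau> j * binomial_kernel h q j"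
proof -
  have "real j - 1 \<noteq> 0" using assms by simp
  then show ?thesis using assms by (simp add: jump_weight_def binomial_kernel_def)
qed

text \<open>
  For \<open>h q \<le> 1\<close> Bernoulli's inequality bounds the terms of the series by \<open>j pmf p j\<close>.
\<close>

lemma Psi_breve_eq_integral:
  assumes mean: "(\<lambda>j. real j * pmf p j) sums 1" and h: "h > 0" and \<tau>: "\<tau> > 0"
    and q: "0 \<le> q" "h * q \<le> 1"
  shows "Psi_breve p h \<tau> q = (\<integral>j. jump_weight p \<tau> j * binomial_kernel h q j \<partial>count_space {2..})"
    and "integrable (count_space {2..}) (\<lambda>j. jump_weight p \<tau> j * binomial_kernel h q j)"
proof -
  let ?f = "\<lambda>j. ((1 - h * q) ^ j - 1 + real j * (h * q)) * pmf p j"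
  have hq: "0 \<le> h * q" using h q by simp
  note I = mean_integrable[OF mean]
  have f: "integrable (count_space {2..}) ?f"
  proof (rule Bochner_Integration.integrable_bound[OF I])
    show "AE j in count_space {2..}. norm (?f j) \<le> norm (real j * pmf p j)"
    proof (rule AE_I2)
      fix j :: nat
      have "0 \<le> (1 - h * q) ^ j - 1 + real j * (h * q)"
        using Bernoulli_inequality[of "- (h * q)" j] q by simp
      moreover have "(1 - h * q) ^ j \<le> 1" using hq q by (intro power_le_one) auto
      moreover have "real j * (h * q) \<le> real j" using q by (simp add: mult_left_le)
      ultimately have "\<bar>(1 - h * q) ^ j - 1 + real j * (h * q)\<bar> \<le> real j" by linarith
      then show "norm (?f j) \<le> norm (real j * pmf p j)"
        by (simp add: abs_mult mult_right_mono)
    qed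
  qed auto
  then have abs: "Infinite_Set_Sum.abs_summable_on ?f {2..}"
    by (simp add: Infinite_Set_Sum.abs_summable_on_def)
  have "Psi_hat p (h * q) = infsetsum ?f {2..}"
    unfolding Psi_hat_def using infsetsum_infsum[OF abs] by simp
  also have "\<dots> = (\<integral>j. ?f j \<partial>count_space {2..})"
    by (simp add: infsetsum_def)
  finally have "Psi_breve p h \<tau> q = (\<integral>j. ?f j / (\<tau> * h) \<partial>count_space {2..})"
    by (simp add: Psi_breve_def)
  also have "\<dots> = (\<integral>j. jump_weight p \<tau> j * binomial_kernel h q j \<partial>count_space {2..})"
    using h by (intro Bochner_Integration.integral_cong) (auto simp: binomial_term_eq)
  finally show "Psi_breve p h \<tau> q = (\<integral>j. jump_weight p \<tau> j * binomial_kernel h q j \<partial>count_space {2..})" .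
  have "integrable (count_space {2..}) (\<lambda>j. ?f j / (\<tau> * h))"
    using f by (intro integrable_divide)
  then show "integrable (count_space {2..}) (\<lambda>j. jump_weight p \<tau> j * binomial_kernel h q j)"
    by (rule Bochner_Integration.integrable_cong[THEN iffD1, rotated -1])
       (use h in \<open>auto simp: binomial_term_eq\<close>)
qed

text \<open>
  The only link between \<open>Psi_breve\<close> and the measures: both halves of the theorem use
  it, with the mass on the right-hand side bounded.
\<close>

lemma Psi_breve_close:
  assumes q: "q > 0" and e: "e > 0"
  shows "\<forall>\<^sub>F h in at_right 0. \<forall>p \<tau>. (\<lambda>j. real j * pmf p j) sums 1 \<longrightarrow> \<tau> > 0 \<longrightarrow>
    \<bar>Psi_breve p h \<tau> q - (\<integral>x. levy_test q x \<partial>truncated_measure (mu_breve p h \<tau>))\<bar>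
      \<le> e * (\<integral>x. 1 \<partial>truncated_measure (mu_breve p h \<tau>))"
proof -
  have "\<forall>\<^sub>F h in at_right 0. h < 1 / q"
    using q by (intro eventually_at_rightI[of 0 "1 / q"]) auto
  with binomial_kernel_close[OF assms] eventually_at_right_less[of 0] show ?thesis
  proof eventually_elim
    case (elim h)
    have h: "h > 0" "h * q \<le> 1" "0 \<le> q" using elim q by (auto simp: field_simps)
    show ?case
    proof (intro allI impI)
      fix p :: "nat pmf" and \<tau> :: real
      assume mean: "(\<lambda>j. real j * pmf p j) sums 1" and \<tau>: "\<tau> > 0"
      let ?w = "jump_weight p \<tau>" and ?C = "count_space {2::nat..}"
      let ?m = "\<lambda>j. ?w j * min (real j * h) 1"
      let ?t = "\<lambda>j. ?m j * levy_test q (ennreal (real j * h))"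
      have ct: "continuous_on UNIV (levy_test q)" using h by (intro continuous_on_levy_test)
      note P = Psi_breve_eq_integral[OF mean h(1) \<tau> h(3,2)]
      note T = truncated_mu_breve_integral[OF mean h(1) \<tau> ct]
      note M = truncated_mu_breve_integral[OF mean h(1) \<tau> continuous_on_const[of UNIV 1]]
      have "Psi_breve p h \<tau> q - (\<integral>x. levy_test q x \<partial>truncated_measure (mu_breve p h \<tau>))
         = (\<integral>j. ?w j * binomial_kernel h q j - ?t j \<partial>?C)"
        unfolding P(1) T(1) by (rule Bochner_Integration.integral_diff[symmetric, OF P(2) T(2)])
      also have "\<bar>\<dots>\<bar> \<le> (\<integral>j. e * (?m j * 1) \<partial>?C)"
      proof (rule order_trans[OF integral_abs_bound integral_mono])
        show "integrable ?C (\<lambda>j. \<bar>?w j * binomial_kernel h q j - ?t j\<bar>)"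
          using P(2) T(2) by (intro integrable_abs Bochner_Integration.integrable_diff)
        show "integrable ?C (\<lambda>j. e * (?m j * 1))"
          using M(2) by (intro integrable_mult_right)
        fix j assume "j \<in> space ?C"
        then have j: "j \<ge> 2" by simp
        have x: "real j * h > 0" using j h by simp
        have "?w j * binomial_kernel h q j - ?t j
            = ?w j * (binomial_kernel h q j - levy_kernel q (real j * h))"
          using x by (simp add: right_diff_distrib del: of_nat_mult)
        also have "\<bar>\<dots>\<bar> = ?w j * \<bar>binomial_kernel h q j - levy_kernel q (real j * h)\<bar>"
          using j \<tau> by (simp add: abs_mult jump_weight_def)
        also have "\<dots> \<le> ?w j * (e * min (real j * h) 1)"
          using elim(1) j \<tau> by (intro mult_left_mono) (auto simp: jump_weight_def)
        finally show "\<bar>?w j * binomial_kernel h q j - ?t j\<bar> \<le> e * (?m j * 1)"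
          by (simp add: mult_ac)
      qed
      also have "\<dots> = e * (\<integral>x. 1 \<partial>truncated_measure (mu_breve p h \<tau>))"
        unfolding M(1) by simp
      finally show "\<bar>Psi_breve p h \<tau> q - (\<integral>x. levy_test q x \<partial>truncated_measure (mu_breve p h \<tau>))\<bar>
      \<le> e * (\<integral>x. 1 \<partial>truncated_measure (mu_breve p h \<tau>))" .
    qed
  qed
qed

section \<open>Levy triples\<close>

lemma truncated_measure_nn_integral:
  assumes sets: "sets \<mu> = sets (restrict_space borel {0<..})" and g: "g \<in> borel_measurable borel"
  shows "(\<integral>\<^sup>+x. g x \<partial>truncated_measure \<mu>) = (\<integral>\<^sup>+x. ennreal (min x 1) * g (ennreal x) \<partial>\<mu>)"
proof -
  have id: "(\<lambda>x. x) \<in> borel_measurable \<mu>"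
    using sets by (simp add: measurable_restrict_space1 cong: measurable_cong_sets)
  have [measurable]: "ennreal \<in> borel_measurable \<mu>" "(\<lambda>x. min x 1) \<in> borel_measurable \<mu>"
    using id by measurable
  have [measurable]: "(\<lambda>x. g (ennreal x)) \<in> borel_measurable \<mu>"
    using g by measurable
  show ?thesis
    unfolding truncated_measure_def using g
    by (subst nn_integral_distr) (auto simp: nn_integral_density)
qed

lemma truncated_measure_emeasure:
  assumes sets: "sets \<mu> = sets (restrict_space borel {0<..})" and A: "A \<in> sets borel"
  shows "emeasure (truncated_measure \<mu>) A = (\<integral>\<^sup>+x. ennreal (min x 1) * indicator A (ennreal x) \<partial>\<mu>)"
  using truncated_measure_nn_integral[OF sets, of "indicator A"] A
  by (simp add: borel_measurable_indicator)

text \<open>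
  The measure on \<open>(0,\<infinity>)\<close> with \<open>min x 1 d\<mu> = d\<kappa>\<close> there. The density vanishes at \<open>0\<close> and \<open>\<infinity>\<close>,
  so the value \<open>1\<close> given to these points only serves to map all of \<open>[0,\<infinity>]\<close> into
  \<open>(0,\<infinity>)\<close>.
\<close>

definition jump_measure :: "ennreal measure \<Rightarrow> real measure" where
  "jump_measure \<kappa> =
     distr (density \<kappa> (\<lambda>x. ennreal (if x = 0 \<or> x = top then 0 else 1 / min (enn2real x) 1)))
       (restrict_space borel {0<..}) (\<lambda>x. if x = 0 \<or> x = top then 1 else enn2real x)"

lemma sets_jump_measure: "sets (jump_measure \<kappa>) = sets (restrict_space borel {0<..})"
  by (simp add: jump_measure_def)

lemma nn_integral_jump_measure:
  assumes [measurable_cong]: "sets \<kappa> = sets borel" and f: "f \<in> borel_measurable (restrict_space borel {0<..})"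
  shows "(\<integral>\<^sup>+x. f x \<partial>jump_measure \<kappa>) =
    (\<integral>\<^sup>+x. ennreal (if x = 0 \<or> x = top then 0 else 1 / min (enn2real x) 1)
        * f (if x = 0 \<or> x = top then 1 else enn2real x) \<partial>\<kappa>)"
proof -
  have r: "(\<lambda>x. if x = 0 \<or> x = top then 1 else enn2real x) \<in> \<kappa> \<rightarrow>\<^sub>M restrict_space borel {0<..}"
    by (intro measurable_restrict_space2) (auto simp: enn2real_positive_iff less_top zero_less_iff_neq_zero)
  show ?thesis
    unfolding jump_measure_def using r f
    by (subst nn_integral_distr) (auto simp: nn_integral_density)
qed

lemma Levy_triple_of_jump_measure:
  assumes "finite_measure \<kappa>" and [measurable_cong]: "sets \<kappa> = sets borel"
  shows "Levy_triple_of \<kappa> (measure \<kappa> {0}) (measure \<kappa> {top}) (jump_measure \<kappa>)"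
proof -
  interpret finite_measure \<kappa> by fact
  have id: "(\<lambda>x::real. x) \<in> borel_measurable (restrict_space borel {0<..})"
    by (intro measurable_restrict_space1) auto
  have *: "(\<integral>\<^sup>+x. ennreal (min x 1) * indicator A (ennreal x) \<partial>jump_measure \<kappa>) = emeasure \<kappa> (A - {0, top})"
    if A: "A \<in> sets borel" for A :: "ennreal set"
  proof -
    have "(\<lambda>x. ennreal (min x 1) * indicator A (ennreal x)) \<in> borel_measurable (restrict_space borel {0<..})"
      using id A by measurable
    then have "(\<integral>\<^sup>+x. ennreal (min x 1) * indicator A (ennreal x) \<partial>jump_measure \<kappa>)
        = (\<integral>\<^sup>+x. indicator (A - {0, top}) x \<partial>\<kappa>)"
    proof (subst nn_integral_jump_measure[OF assms(2)], assumption, intro nn_integral_cong)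
      fix x :: ennreal
      show "ennreal (if x = 0 \<or> x = top then 0 else 1 / min (enn2real x) 1) *
          (ennreal (min (if x = 0 \<or> x = top then 1 else enn2real x) 1) *
            indicator A (ennreal (if x = 0 \<or> x = top then 1 else enn2real x)))
        = indicator (A - {0, top}) x"
        by (cases x rule: ennreal_exhaust_three)
           (auto simp: indicator_def ennreal_mult[symmetric] min_def)
    qed
    also have "\<dots> = emeasure \<kappa> (A - {0, top})"
      using A by (intro nn_integral_indicator) (simp add: assms(2))
    finally show ?thesis .
  qed
  have "(\<integral>\<^sup>+x. ennreal (min x 1) \<partial>jump_measure \<kappa>) < \<infinity>"
    using *[of UNIV] emeasure_finite[of "UNIV - {0, top}"] by (simp add: less_top[symmetric])
  then have "Levy_triple (measure \<kappa> {0}) (measure \<kappa> {top}) (jump_measure \<kappa>)"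
    by (simp add: Levy_triple_def sets_jump_measure)
  moreover have "emeasure \<kappa> A = ennreal (measure \<kappa> {0}) * emeasure (return borel 0) A +
        ennreal (measure \<kappa> {top}) * emeasure (return borel \<infinity>) A +
        emeasure (truncated_measure (jump_measure \<kappa>)) A" if A: "A \<in> sets borel" for A
  proof -
    have t: "emeasure (truncated_measure (jump_measure \<kappa>)) A = emeasure \<kappa> (A - {0, top})"
      using truncated_measure_emeasure[OF sets_jump_measure A] *[OF A] by simp
    have "emeasure \<kappa> A = emeasure \<kappa> ((A \<inter> {0}) \<union> (A \<inter> {top}) \<union> (A - {0, top}))"
      by (intro arg_cong[of _ _ "emeasure \<kappa>"]) auto
    also have "\<dots> = emeasure \<kappa> (A \<inter> {0}) + emeasure \<kappa> (A \<inter> {top}) + emeasure \<kappa> (A - {0, top})"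
      using A by (subst plus_emeasure[symmetric], auto simp: assms(2))+
    also have "emeasure \<kappa> (A \<inter> {0}) = ennreal (measure \<kappa> {0}) * emeasure (return borel 0) A"
      using A by (cases "0 \<in> A") (auto simp: emeasure_eq_measure)
    also have "emeasure \<kappa> (A \<inter> {top}) = ennreal (measure \<kappa> {top}) * emeasure (return borel \<infinity>) A"
      using A by (cases "top \<in> A") (auto simp: emeasure_eq_measure)
    finally show ?thesis unfolding t .
  qed
  ultimately show ?thesis by (simp add: Levy_triple_of_def)
qed

text \<open>
  A Levy triple of \<open>\<kappa>\<close> is recovered from \<open>\<kappa>\<close>: the truncated measure does not charge \<open>0\<close> and
  \<open>\<infinity>\<close>, so \<open>a\<close> and \<open>b\<close> are the atoms of \<open>\<kappa>\<close> there, and \<open>\<kappa>\<close> restricted to \<open>(0,\<infinity>)\<close> is the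
  truncated measure, from which \<open>\<mu>\<close> results by dividing out \<open>min x 1\<close>.
\<close>

context
  fixes \<kappa> :: "ennreal measure" and a b :: real and \<mu> :: "real measure"
  assumes kfin: "finite_measure \<kappa>" and ksets [measurable_cong]: "sets \<kappa> = sets borel"
    and triple: "Levy_triple_of \<kappa> a b \<mu>"
begin

interpretation finite_measure \<kappa> by (fact kfin)

lemma triple_facts:
  "0 \<le> a" "0 \<le> b" "sets \<mu> = sets (restrict_space borel {0<..})"
  "(\<integral>\<^sup>+x. ennreal (min x 1) \<partial>\<mu>) < \<infinity>" "space \<mu> = {0<..}"
  "A \<in> sets borel \<Longrightarrow> emeasure \<kappa> A = ennreal a * indicator A 0 + ennreal b * indicator A top
     + emeasure (truncated_measure \<mu>) A"
proof -
  show m: "0 \<le> a" "0 \<le> b" "sets \<mu> = sets (restrict_space borel {0<..})"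
    "(\<integral>\<^sup>+x. ennreal (min x 1) \<partial>\<mu>) < \<infinity>"
    using triple by (auto simp: Levy_triple_of_def Levy_triple_def)
  show "space \<mu> = {0<..}"
    using sets_eq_imp_space_eq[OF m(3)] by (simp add: space_restrict_space)
  show "A \<in> sets borel \<Longrightarrow> emeasure \<kappa> A = ennreal a * indicator A 0 + ennreal b * indicator A top
     + emeasure (truncated_measure \<mu>) A"
    using triple by (auto simp: Levy_triple_of_def)
qed

lemma truncated_measure_endpoints:
  "emeasure (truncated_measure \<mu>) {0} = 0" "emeasure (truncated_measure \<mu>) {top} = 0"
proof -
  show "emeasure (truncated_measure \<mu>) {0} = 0"
    by (subst truncated_measure_emeasure[OF triple_facts(3)])
       (auto simp: triple_facts(5) nn_integral_0_iff_AE indicator_def intro!: nn_integral_zero')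
  show "emeasure (truncated_measure \<mu>) {top} = 0"
    by (subst truncated_measure_emeasure[OF triple_facts(3)])
       (auto simp: triple_facts(5) nn_integral_0_iff_AE indicator_def intro!: nn_integral_zero')
qed

lemma triple_atoms: "a = measure \<kappa> {0}" "b = measure \<kappa> {top}"
proof -
  have "ennreal a = emeasure \<kappa> {0}" "ennreal b = emeasure \<kappa> {top}"
    using triple_facts(6)[of "{0}"] triple_facts(6)[of "{top}"] by (auto simp: truncated_measure_endpoints)
  then show "a = measure \<kappa> {0}" "b = measure \<kappa> {top}"
    using triple_facts(1,2) by (auto simp: emeasure_eq_measure)
qed

lemma density_interior_eq: "density \<kappa> (indicator (- {0, top})) = truncated_measure \<mu>"
proof (rule measure_eqI)
  fix A assume "A \<in> sets (density \<kappa> (indicator (- {0, top})))"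
  then have A [measurable]: "A \<in> sets borel" by (simp add: ksets)
  have "emeasure (density \<kappa> (indicator (- {0, top}))) A
      = (\<integral>\<^sup>+x. indicator (- {0, top}) x * indicator A x \<partial>\<kappa>)"
    by (rule emeasure_density) (auto simp: ksets)
  also have "\<dots> = (\<integral>\<^sup>+x. indicator (A - {0, top}) x \<partial>\<kappa>)"
    by (intro nn_integral_cong) (auto split: split_indicator)
  also have "\<dots> = emeasure \<kappa> (A - {0, top})"
    using A by (intro nn_integral_indicator) (simp add: ksets)
  also have "\<dots> = emeasure (truncated_measure \<mu>) (A - {0, top})"
    using A by (subst triple_facts(6)) auto
  also have "\<dots> = emeasure (truncated_measure \<mu>) A"
  proof -
    have "{0, top} \<in> null_sets (truncated_measure \<mu>)"
      using null_sets.Un[of "{0}" "truncated_measure \<mu>" "{top}"] truncated_measure_endpoints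
      by (auto simp: null_sets_def insert_commute)
    then show ?thesis using A by (intro emeasure_Diff_null_set) auto
  qed
  finally show "emeasure (density \<kappa> (indicator (- {0, top}))) A = emeasure (truncated_measure \<mu>) A" .
qed (simp add: ksets)

lemma triple_jump_measure: "\<mu> = jump_measure \<kappa>"
proof (rule measure_eqI)
  show "sets \<mu> = sets (jump_measure \<kappa>)"
    by (simp add: triple_facts(3) sets_jump_measure)
  fix A assume "A \<in> sets \<mu>"
  then have A: "A \<in> sets (restrict_space borel {0<..})" by (simp add: triple_facts(3))
  let ?w = "\<lambda>x. ennreal (if x = 0 \<or> x = top then 0 else 1 / min (enn2real x) 1)"
  let ?r = "\<lambda>x. if x = 0 \<or> x = top then 1 else enn2real x"
  have "A \<in> sets borel" using A by (auto simp: sets_restrict_space)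
  then have [measurable]: "(\<lambda>x. ?w x * indicator A (?r x)) \<in> borel_measurable borel"
    by measurable
  have "emeasure (jump_measure \<kappa>) A = (\<integral>\<^sup>+x. indicator A x \<partial>jump_measure \<kappa>)"
    using A by (simp add: sets_jump_measure)
  also have "\<dots> = (\<integral>\<^sup>+x. ?w x * indicator A (?r x) \<partial>\<kappa>)"
    using A by (intro nn_integral_jump_measure[OF ksets]) auto
  also have "\<dots> = (\<integral>\<^sup>+x. indicator (- {0, top}) x * (?w x * indicator A (?r x)) \<partial>\<kappa>)"
    by (intro nn_integral_cong) (auto split: split_indicator)
  also have "\<dots> = (\<integral>\<^sup>+x. ?w x * indicator A (?r x) \<partial>truncated_measure \<mu>)"
    unfolding density_interior_eq[symmetric] by (subst nn_integral_density) auto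
  also have "\<dots> = (\<integral>\<^sup>+x. ennreal (min x 1) * (?w (ennreal x) * indicator A (?r (ennreal x))) \<partial>\<mu>)"
    by (intro truncated_measure_nn_integral triple_facts) measurable
  also have "\<dots> = (\<integral>\<^sup>+x. indicator A x \<partial>\<mu>)"
    by (intro nn_integral_cong)
       (auto simp: triple_facts(5) ennreal_mult[symmetric] min_def split: split_indicator)
  also have "\<dots> = emeasure \<mu> A" using \<open>A \<in> sets \<mu>\<close> by simp
  finally show "emeasure \<mu> A = emeasure (jump_measure \<kappa>) A" ..
qed

lemma triple_integral:
  fixes g :: "ennreal \<Rightarrow> real"
  assumes g: "continuous_on UNIV g"
  shows "(\<integral>x. g x \<partial>\<kappa>) = a * g 0 + b * g top + (\<integral>x. g x \<partial>truncated_measure \<mu>)"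
    and "integrable (truncated_measure \<mu>) g"
proof -
  obtain B where B: "B > 0" "\<And>x. \<bar>g x\<bar> \<le> B"
    using bounded_continuous_ennreal[OF g] by blast
  have gm [measurable]: "g \<in> borel_measurable borel"
    using g by (rule borel_measurable_continuous_onI)
  have ig: "integrable \<kappa> (\<lambda>x. indicator A x * g x)" if [measurable]: "A \<in> sets borel" for A
    by (rule integrable_const_bound[where B = B]) (use B in \<open>auto simp: indicator_def less_imp_le\<close>)
  have dens: "density \<kappa> (indicator (- {0, top})) = density \<kappa> (\<lambda>x. ennreal (indicator (- {0, top}) x))"
    by (intro density_cong) (auto split: split_indicator)
  have t1: "(\<integral>x. g x \<partial>truncated_measure \<mu>) = (\<integral>x. indicator (- {0, top}) x * g x \<partial>\<kappa>)"
    unfolding density_interior_eq[symmetric] dens by (subst integral_density) auto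
  have "integrable (truncated_measure \<mu>) g \<longleftrightarrow> integrable \<kappa> (\<lambda>x. indicator (- {0, top}) x * g x)"
    unfolding density_interior_eq[symmetric] dens by (subst integrable_density) auto
  then show "integrable (truncated_measure \<mu>) g" using ig[of "- {0, top}"] by simp
  have point: "(\<integral>x. indicator {c} x * g x \<partial>\<kappa>) = measure \<kappa> {c} * g c" for c
  proof -
    have "(\<integral>x. indicator {c} x * g x \<partial>\<kappa>) = (\<integral>x. indicator {c} x * g c \<partial>\<kappa>)"
      by (intro Bochner_Integration.integral_cong) (auto split: split_indicator)
    then show ?thesis by (simp add: ksets sets_eq_imp_space_eq[OF ksets])
  qed
  have "(\<integral>x. g x \<partial>\<kappa>) = (\<integral>x. indicator {0} x * g x + indicator {top} x * g x
      + indicator (- {0, top}) x * g x \<partial>\<kappa>)"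
    by (intro Bochner_Integration.integral_cong) (auto split: split_indicator)
  also have "\<dots> = (\<integral>x. indicator {0} x * g x \<partial>\<kappa>) + (\<integral>x. indicator {top} x * g x \<partial>\<kappa>)
      + (\<integral>x. indicator (- {0, top}) x * g x \<partial>\<kappa>)"
    using ig[of "{0}"] ig[of "{top}"] ig[of "- {0, top}"] by simp
  finally show "(\<integral>x. g x \<partial>\<kappa>) = a * g 0 + b * g top + (\<integral>x. g x \<partial>truncated_measure \<mu>)"
    unfolding point t1 triple_atoms by simp
qed

lemma levy_kernel_integrable: "q \<ge> 0 \<Longrightarrow> integrable \<mu> (levy_kernel q)"
  and integral_levy_test: "q \<ge> 0 \<Longrightarrow> (\<integral>x. levy_test q x \<partial>\<kappa>) = Levy_Psi a b \<mu> q"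
proof -
  assume q: "q \<ge> 0"
  note c = continuous_on_levy_test[OF q]
  have m: "levy_test q \<in> borel_measurable borel"
    using c by (rule borel_measurable_continuous_onI)
  have eq: "min x 1 * levy_test q (ennreal x) = levy_kernel q x" if "x \<in> space \<mu>" for x
    using that by (simp add: triple_facts(5))
  have "integrable \<mu> (\<lambda>x. min x 1 * levy_test q (ennreal x))"
    using triple_integral(2)[OF c] truncated_measure_integral(2)[OF triple_facts(3) m] by simp
  then show "integrable \<mu> (levy_kernel q)"
    using eq by (simp cong: Bochner_Integration.integrable_cong)
  have "(\<integral>x. levy_test q x \<partial>truncated_measure \<mu>) = (\<integral>x. levy_kernel q x \<partial>\<mu>)"
    unfolding truncated_measure_integral(1)[OF triple_facts(3) m]
    using eq by (intro Bochner_Integration.integral_cong) auto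
  then show "(\<integral>x. levy_test q x \<partial>\<kappa>) = Levy_Psi a b \<mu> q"
    unfolding triple_integral(1)[OF c] by (simp add: Levy_Psi_def levy_kernel_def)
qed

end

lemma ex1_Levy_triple_of:
  assumes "finite_measure \<kappa>" "sets \<kappa> = sets borel"
  shows "\<exists>!(a, b, \<mu>). Levy_triple_of \<kappa> a b \<mu>"
proof (rule ex1I[of _ "(measure \<kappa> {0}, measure \<kappa> {top}, jump_measure \<kappa>)"])
  show "case (measure \<kappa> {0}, measure \<kappa> {top}, jump_measure \<kappa>) of (a, b, \<mu>) \<Rightarrow> Levy_triple_of \<kappa> a b \<mu>"
    using Levy_triple_of_jump_measure[OF assms] by simp
  fix t assume "case t of (a, b, \<mu>) \<Rightarrow> Levy_triple_of \<kappa> a b \<mu>"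
  then show "t = (measure \<kappa> {0}, measure \<kappa> {top}, jump_measure \<kappa>)"
    using triple_atoms[OF assms] triple_jump_measure[OF assms] by (auto split: prod.splits)
qed

section \<open>Derivatives of the rescaled series\<close>

text \<open>
  Exhibiting a whole family of derivatives at once settles both the existence and the
  value of the iterated \<open>deriv\<close>.
\<close>

lemma iterated_deriv:
  fixes F :: "nat \<Rightarrow> real \<Rightarrow> real"
  assumes "open S" and f: "\<And>q. q \<in> S \<Longrightarrow> f q = F 0 q"
    and F: "\<And>m q. q \<in> S \<Longrightarrow> (F m has_real_derivative F (Suc m) q) (at q)"
  shows "q \<in> S \<Longrightarrow> (deriv ^^ m) f q = F m q" and "times_differentiable_on m f S"
proof -
  have *: "\<forall>q\<in>S. (deriv ^^ m) f q = F m q \<and> ((deriv ^^ m) f has_real_derivative F (Suc m) q) (at q)" for m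
  proof (induction m)
    case 0
    show ?case
      using has_field_derivative_transform_within_open[OF F \<open>open S\<close>, of _ 0 f] f by auto
  next
    case (Suc m)
    then have eq: "(deriv ^^ Suc m) f q = F (Suc m) q" if "q \<in> S" for q
      using that by (auto intro: DERIV_imp_deriv)
    then show ?case
      using has_field_derivative_transform_within_open[OF F \<open>open S\<close>, of _ "Suc m" "(deriv ^^ Suc m) f"] by auto
  qed
  show "q \<in> S \<Longrightarrow> (deriv ^^ m) f q = F m q" using * by blast
  show "times_differentiable_on m f S"
    unfolding times_differentiable_on_def using * real_differentiable_def by blast
qed

text \<open>
  The \<open>m\<close>-th derivative of the probability generating function of \<open>p\<close>.
\<close>

definition gen_fun_deriv :: "nat pmf \<Rightarrow> nat \<Rightarrow> real \<Rightarrow> real" where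
  "gen_fun_deriv p m z = (\<Sum>n. (diffs ^^ m) (pmf p) n * z ^ n)"

lemma pmf_nat_sums_1: "pmf (p :: nat pmf) sums 1"
proof -
  have "(\<lambda>n. measure_pmf.prob p {n}) sums measure_pmf.prob p (\<Union>n. {n})"
    by (intro measure_pmf.finite_measure_UNION) (auto simp: disjoint_family_on_def)
  then show ?thesis by (simp add: pmf.rep_eq)
qed

lemma gen_fun_deriv_summable:
  assumes "\<bar>z\<bar> < 1"
  shows "summable (\<lambda>n. (diffs ^^ m) (pmf p) n * z ^ n)"
  using assms
proof (induction m arbitrary: z)
  case 0
  have "summable (\<lambda>n. norm (pmf p n * z ^ n))"
  proof (rule summable_comparison_test')
    show "summable (pmf p)" using pmf_nat_sums_1 by (rule sums_summable)
    show "norm (norm (pmf p n * z ^ n)) \<le> pmf p n" if "n \<ge> 0" for n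
      using 0 by (auto simp: abs_mult power_abs intro!: mult_right_le_one_le power_le_one)
  qed
  then show ?case by (simp only: funpow.simps id_apply) (rule summable_norm_cancel)
next
  case (Suc m)
  have "summable (\<lambda>n. diffs ((diffs ^^ m) (pmf p)) n * z ^ n)"
    by (rule termdiff_converges[of z 1]) (use Suc in auto)
  then show ?case by simp
qed

lemma gen_fun_deriv_has_derivative:
  assumes "\<bar>z\<bar> < 1"
  shows "(gen_fun_deriv p m has_real_derivative gen_fun_deriv p (Suc m) z) (at z)"
  unfolding gen_fun_deriv_def using assms gen_fun_deriv_summable
  by (simp only: funpow.simps o_def) (rule termdiffs_strong'[of 1], auto)

lemma gen_fun_deriv_nonneg:
  assumes "0 \<le> z" "z < 1"
  shows "0 \<le> gen_fun_deriv p m z"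
proof -
  have "0 \<le> (diffs ^^ m) (pmf p) n" for n
    by (induction m arbitrary: n) (auto simp: diffs_def)
  then show ?thesis
    unfolding gen_fun_deriv_def using assms gen_fun_deriv_summable[of z m p]
    by (intro suminf_nonneg) auto
qed

text \<open>
  The indices \<open>0\<close> and \<open>1\<close> contribute \<open>0\<close> to the series, so the sum may start at \<open>0\<close>; the
  parts \<open>- 1\<close> and \<open>j q\<close> sum to \<open>- 1\<close> and \<open>q\<close> because the total mass and the mean are \<open>1\<close>.
\<close>

lemma Psi_hat_eq_gen_fun:
  assumes mean: "(\<lambda>j. real j * pmf p j) sums 1" and q: "0 < q" "q < 2"
  shows "Psi_hat p q = gen_fun_deriv p 0 (1 - q) - 1 + q"
proof -
  let ?f = "\<lambda>j. ((1 - q) ^ j - 1 + real j * q) * pmf p j"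
  have z: "\<bar>1 - q\<bar> < 1" using q by auto
  have "(\<lambda>j. pmf p j * (1 - q) ^ j - pmf p j + q * (real j * pmf p j))
      sums (gen_fun_deriv p 0 (1 - q) - 1 + q * 1)"
    using gen_fun_deriv_summable[OF z, of 0 p]
    by (intro sums_add sums_diff sums_mult mean pmf_nat_sums_1)
       (auto simp: gen_fun_deriv_def)
  then have s: "?f sums (gen_fun_deriv p 0 (1 - q) - 1 + q)"
    by (simp add: algebra_simps)
  have n: "summable (\<lambda>j. norm (?f j))"
  proof (rule summable_comparison_test')
    show "summable (\<lambda>j. 2 * pmf p j + q * (real j * pmf p j))"
      using mean pmf_nat_sums_1[of p] by (intro summable_add summable_mult) (auto simp: sums_iff)
    fix j :: nat assume "j \<ge> 0"
    have "\<bar>(1 - q) ^ j\<bar> \<le> 1" using z by (auto simp: power_abs intro: power_le_one)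
    then have "\<bar>(1 - q) ^ j - 1 + real j * q\<bar> \<le> 2 + real j * q"
      using q by (smt (verit) mult_nonneg_nonneg of_nat_0_le_iff)
    then have "\<bar>(1 - q) ^ j - 1 + real j * q\<bar> * pmf p j \<le> (2 + real j * q) * pmf p j"
      by (intro mult_right_mono) auto
    moreover have "norm (norm (?f j)) = \<bar>(1 - q) ^ j - 1 + real j * q\<bar> * pmf p j"
      by (simp add: abs_mult)
    ultimately show "norm (norm (?f j)) \<le> 2 * pmf p j + q * (real j * pmf p j)"
      by (simp only: distrib_right mult.assoc mult.commute[of _ q] mult.left_commute[of _ q])
  qed
  have "Psi_hat p q = infsum ?f UNIV"
    unfolding Psi_hat_def
  proof (rule infsum_cong_neutral)
    fix j :: nat assume "j \<in> UNIV - {2..}"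
    then have "j = 0 \<or> j = 1" by auto
    then show "?f j = 0" by auto
  qed auto
  also have "\<dots> = gen_fun_deriv p 0 (1 - q) - 1 + q"
    by (rule infsumI[OF norm_summable_imp_has_sum[OF n s]])
  finally show ?thesis .
qed

definition Psi_breve_deriv :: "nat pmf \<Rightarrow> real \<Rightarrow> real \<Rightarrow> nat \<Rightarrow> real \<Rightarrow> real" where
  "Psi_breve_deriv p h \<tau> m q =
     ((- h) ^ m * gen_fun_deriv p m (1 - h * q)
       + (if m = 0 then h * q - 1 else if m = 1 then h else 0)) / (\<tau> * h)"

lemma Psi_breve_deriv_0:
  assumes "(\<lambda>j. real j * pmf p j) sums 1" "h > 0" "q \<in> {0<..<2 / h}"
  shows "Psi_breve p h \<tau> q = Psi_breve_deriv p h \<tau> 0 q"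
  using Psi_hat_eq_gen_fun[of p "h * q"] assms
  by (simp add: Psi_breve_def Psi_breve_deriv_def field_simps)

lemma Psi_breve_deriv_has_derivative:
  assumes "h > 0" "\<tau> > 0" "q \<in> {0<..<2 / h}"
  shows "(Psi_breve_deriv p h \<tau> m has_real_derivative Psi_breve_deriv p h \<tau> (Suc m) q) (at q)"
proof -
  have z: "\<bar>1 - h * q\<bar> < 1"
    using assms by (auto simp: abs_less_iff field_simps)
  have "((\<lambda>q. gen_fun_deriv p m (1 - h * q)) has_real_derivative
      gen_fun_deriv p (Suc m) (1 - h * q) * (- h)) (at q)"
    by (rule DERIV_chain2[where g = "\<lambda>q. 1 - h * q", OF gen_fun_deriv_has_derivative[OF z]]) (auto intro!: derivative_eq_intros)
  moreover have "((\<lambda>q. if m = 0 then h * q - 1 else if m = 1 then h else 0) has_real_derivative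
      (if Suc m = 0 then h * q - 1 else if Suc m = 1 then h else 0)) (at q)"
    by (cases "m = 0") (auto intro!: derivative_eq_intros)
  ultimately show ?thesis
    unfolding Psi_breve_deriv_def using assms(2)
    by (auto intro!: derivative_eq_intros simp: mult_ac)
qed

text \<open>
  For \<open>q \<le> 1 / h\<close> the generating function is evaluated at \<open>1 - h q \<ge> 0\<close>, where all its
  derivatives are nonnegative, and each differentiation in \<open>q\<close> brings out a factor \<open>- h\<close>.
  The affine part is gone from the second derivative on.
\<close>

lemma Psi_breve_deriv_sign:
  assumes "h > 0" "\<tau> > 0" "q \<in> {0<..1 / h}" "m \<ge> 2"
  shows "0 \<le> (- 1) ^ m * Psi_breve_deriv p h \<tau> m q"
proof -
  have "0 \<le> gen_fun_deriv p m (1 - h * q)"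
    using assms by (intro gen_fun_deriv_nonneg) (auto simp: field_simps)
  moreover have "(- 1) ^ m * Psi_breve_deriv p h \<tau> m q = h ^ m * gen_fun_deriv p m (1 - h * q) / (\<tau> * h)"
  proof -
    have "(- 1) ^ m * (- h) ^ m = h ^ m" by (simp flip: power_mult_distrib)
    then have "(- 1) ^ m * ((- h) ^ m * gen_fun_deriv p m (1 - h * q)) = h ^ m * gen_fun_deriv p m (1 - h * q)"
      by (simp only: mult.assoc[symmetric])
    then show ?thesis using assms(4) by (simp add: Psi_breve_deriv_def)
  qed
  ultimately show ?thesis using assms by simp
qed

section \<open>Derivatives of the limit\<close>

text \<open>
  By the mean value theorem the difference quotients are bounded by the bound \<open>g\<close> on the
  derivative, so dominated convergence applies along every sequence tending to \<open>q\<close>.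
\<close>

lemma has_real_derivative_integral:
  fixes f f' :: "real \<Rightarrow> 'a \<Rightarrow> real"
  assumes "open S" "convex S" "q \<in> S"
    and int: "\<And>t. t \<in> S \<Longrightarrow> integrable M (f t)"
    and D: "\<And>t x. t \<in> S \<Longrightarrow> x \<in> space M \<Longrightarrow> ((\<lambda>t. f t x) has_real_derivative f' t x) (at t)"
    and meas: "f' q \<in> borel_measurable M"
    and g: "integrable M g" "\<And>t x. t \<in> S \<Longrightarrow> x \<in> space M \<Longrightarrow> \<bar>f' t x\<bar> \<le> g x"
  shows "((\<lambda>t. \<integral>x. f t x \<partial>M) has_real_derivative (\<integral>x. f' q x \<partial>M)) (at q)"
proof -
  have "((\<lambda>t. ((\<integral>x. f t x \<partial>M) - (\<integral>x. f q x \<partial>M)) / (t - q)) \<longlongrightarrow> (\<integral>x. f' q x \<partial>M)) (at q within S)"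
    unfolding tendsto_at_iff_sequentially
  proof (intro allI impI)
    fix X assume X: "\<forall>i. X i \<in> S - {q}" "X \<longlonglongrightarrow> q"
    have "(\<lambda>i. \<integral>x. (f (X i) x - f q x) / (X i - q) \<partial>M) \<longlonglongrightarrow> (\<integral>x. f' q x \<partial>M)"
    proof (rule integral_dominated_convergence[where w = g])
      show "(\<lambda>x. (f (X i) x - f q x) / (X i - q)) \<in> borel_measurable M" for i
        using int X \<open>q \<in> S\<close> by (intro borel_measurable_divide borel_measurable_diff) auto
      show "AE x in M. (\<lambda>i. (f (X i) x - f q x) / (X i - q)) \<longlonglongrightarrow> f' q x"
      proof (rule AE_I2)
        fix x assume "x \<in> space M"
        then have "((\<lambda>t. (f t x - f q x) / (t - q)) \<longlongrightarrow> f' q x) (at q)"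
          using D[OF \<open>q \<in> S\<close>, of x] unfolding has_field_derivative_iff by simp
        then show "(\<lambda>i. (f (X i) x - f q x) / (X i - q)) \<longlonglongrightarrow> f' q x"
          using X unfolding tendsto_at_iff_sequentially by (auto simp: o_def)
      qed
      fix i
      show "AE x in M. norm ((f (X i) x - f q x) / (X i - q)) \<le> g x"
      proof (rule AE_I2)
        fix x assume x: "x \<in> space M"
        have "norm (f (X i) x - f q x) \<le> g x * norm (X i - q)"
        proof (rule field_differentiable_bound[OF \<open>convex S\<close>])
          show "((\<lambda>t. f t x) has_field_derivative f' t x) (at t within S)" if "t \<in> S" for t
            using D[OF that x] by (rule has_field_derivative_at_within)
          show "norm (f' t x) \<le> g x" if "t \<in> S" for t using g(2)[OF that x] by simp
        qed (use X \<open>q \<in> S\<close> in auto)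
        then show "norm ((f (X i) x - f q x) / (X i - q)) \<le> g x"
          using X by (auto simp: field_simps)
      qed
    qed (use meas g in auto)
    moreover have "(\<integral>x. (f (X i) x - f q x) / (X i - q) \<partial>M)
        = ((\<integral>x. f (X i) x \<partial>M) - (\<integral>x. f q x \<partial>M)) / (X i - q)" for i
      using Bochner_Integration.integral_diff[OF int int, of "X i" q] X \<open>q \<in> S\<close> by simp
    ultimately show "((\<lambda>t. ((\<integral>x. f t x \<partial>M) - (\<integral>x. f q x \<partial>M)) / (t - q)) \<circ> X)
        \<longlonglongrightarrow> (\<integral>x. f' q x \<partial>M)"
      by (simp only: o_def)
  qed
  then show ?thesis
    using at_within_open[OF \<open>q \<in> S\<close> \<open>open S\<close>] by (simp add: has_field_derivative_iff)
qed

text \<open>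
  The \<open>m\<close>-th derivative of \<open>levy_kernel q x\<close> in \<open>q\<close>.
\<close>

definition levy_kernel_deriv :: "nat \<Rightarrow> real \<Rightarrow> real \<Rightarrow> real" where
  "levy_kernel_deriv m q x =
     ((- x) ^ m * exp (- q * x) + (if m = 0 then q * x - 1 else if m = 1 then x else 0)) / x"

lemma levy_kernel_deriv_0: "levy_kernel_deriv 0 = levy_kernel"
  by (auto simp: levy_kernel_deriv_def levy_kernel_def fun_eq_iff algebra_simps)

lemma levy_kernel_deriv_has_derivative:
  "((\<lambda>q. levy_kernel_deriv m q x) has_real_derivative levy_kernel_deriv (Suc m) q x) (at q)"
proof -
  have "((\<lambda>q. (- x) ^ m * exp (- q * x)) has_real_derivative (- x) ^ m * (exp (- q * x) * (- x))) (at q)"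
    by (auto intro!: derivative_eq_intros)
  moreover have "((\<lambda>q. if m = 0 then q * x - 1 else if m = 1 then x else 0) has_real_derivative
      (if Suc m = 0 then q * x - 1 else if Suc m = 1 then x else 0)) (at q)"
    by (cases "m = 0") (auto intro!: derivative_eq_intros)
  ultimately have "((\<lambda>q. ((- x) ^ m * exp (- q * x) + (if m = 0 then q * x - 1 else if m = 1 then x else 0)) / x)
     has_real_derivative ((- x) ^ m * (exp (- q * x) * (- x)) + (if Suc m = 0 then q * x - 1 else if Suc m = 1 then x else 0)) / x) (at q)"
    by (intro DERIV_cdivide DERIV_add)
  then show ?thesis by (simp add: levy_kernel_deriv_def mult_ac)
qed

lemma power_le_fact_exp:
  fixes y :: real
  assumes "y \<ge> 0"
  shows "y ^ n \<le> fact n * exp y"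
proof -
  have "y ^ n /\<^sub>R fact n \<le> (\<Sum>i. y ^ i /\<^sub>R fact i)"
    using sum_le_suminf[OF summable_exp_generic[of y], of "{n}"] assms by simp
  then show ?thesis by (simp add: exp_def field_simps)
qed

text \<open>
  For \<open>m = 1\<close> the kernel is \<open>1 - exp (- q x)\<close>, at most \<open>1\<close> and at most \<open>b x\<close>. For \<open>m \<ge> 2\<close> it is, up to its sign,
  \<open>x ^ (m - 1) exp (- q x)\<close>; estimating the power \<open>x ^ (m - 1)\<close> against the exponential
  gives the constant bound, and \<open>x ^ (m - 2)\<close> gives the linear one. The exponential decay
  needs \<open>q\<close> bounded away from \<open>0\<close>.
\<close>

lemma levy_kernel_deriv_bound:
  assumes a: "0 < a" and m: "m \<ge> 1"
  obtains C where "C > 0" "\<And>q x. a < q \<Longrightarrow> q < b \<Longrightarrow> 0 < x \<Longrightarrow> \<bar>levy_kernel_deriv m q x\<bar> \<le> C * min x 1"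
proof (cases "m = 1")
  case True
  show ?thesis
  proof (rule that[of "max b 1"])
    fix q x :: real assume *: "a < q" "q < b" "0 < x"
    have k: "levy_kernel_deriv m q x = 1 - exp (- q * x)"
      using * True by (simp add: levy_kernel_deriv_def field_simps)
    have "1 - exp (- q * x) \<le> q * x" using exp_minus_ge[of "q * x"] by simp
    also have "\<dots> \<le> max b 1 * x" using * by (intro mult_right_mono) auto
    finally have "1 - exp (- q * x) \<le> max b 1 * x" .
    moreover have "1 - exp (- q * x) \<le> max b 1 * 1"
      by (smt (verit) exp_gt_zero max.cobounded2)
    moreover have "exp (- q * x) \<le> 1" using * a by simp
    ultimately show "\<bar>levy_kernel_deriv m q x\<bar> \<le> max b 1 * min x 1"
      unfolding k by (auto simp: min_def)
  qed auto
next
  case False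
  then obtain n where n: "m = Suc (Suc n)" using m by (metis One_nat_def Suc_le_D le_antisym not_less_eq_eq)
  define C where "C = max (fact n / a ^ n) (fact (Suc n) / a ^ Suc n)"
  have pw: "x ^ i * exp (- q * x) \<le> fact i / a ^ i" if "a < q" "0 < x" for q x i
  proof -
    have "a ^ i * x ^ i \<le> fact i * exp (a * x)"
      using power_le_fact_exp[of "a * x" i] a that by (simp add: power_mult_distrib)
    also have "\<dots> \<le> fact i * exp (q * x)"
      using that by (intro mult_left_mono) auto
    finally show ?thesis using a by (simp add: exp_minus field_simps)
  qed
  show ?thesis
  proof (rule that[of C])
    show "C > 0" using a by (simp add: C_def less_max_iff_disj)
    fix q x :: real assume *: "a < q" "q < b" "0 < x"
    have "\<bar>levy_kernel_deriv m q x\<bar> = x ^ Suc n * exp (- q * x)"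
      using * by (simp add: levy_kernel_deriv_def n abs_mult power_abs)
    moreover have "x ^ Suc n * exp (- q * x) \<le> C"
      using pw[OF *(1,3), of "Suc n"] unfolding C_def by linarith
    moreover have "x ^ Suc n * exp (- q * x) \<le> C * x"
    proof -
      have "x * (x ^ n * exp (- q * x)) \<le> x * C"
        using pw[OF *(1,3), of n] * unfolding C_def by (intro mult_left_mono) auto
      then show ?thesis by (simp add: mult_ac)
    qed
    ultimately show "\<bar>levy_kernel_deriv m q x\<bar> \<le> C * min x 1"
      by (auto simp: min_def)
  qed
qed

definition Levy_Psi_deriv :: "real \<Rightarrow> real \<Rightarrow> real measure \<Rightarrow> nat \<Rightarrow> real \<Rightarrow> real" where
  "Levy_Psi_deriv a b \<mu> m q =
     (if m = 0 then 1 / 2 * a * q\<^sup>2 + b * q else if m = 1 then a * q + b else if m = 2 then a else 0)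
     + (\<integral>x. levy_kernel_deriv m q x \<partial>\<mu>)"

lemma Levy_Psi_deriv_0: "Levy_Psi a b \<mu> = Levy_Psi_deriv a b \<mu> 0"
  by (auto simp: Levy_Psi_def Levy_Psi_deriv_def levy_kernel_deriv_0 levy_kernel_def[abs_def])

lemma Levy_Psi_deriv_has_derivative:
  assumes sets: "sets \<mu> = sets (restrict_space borel {0<..})"
    and min: "integrable \<mu> (\<lambda>x. min x 1)"
    and ker: "\<And>q. q \<ge> 0 \<Longrightarrow> integrable \<mu> (levy_kernel q)"
    and q: "q > 0"
  shows "(Levy_Psi_deriv a b \<mu> m has_real_derivative Levy_Psi_deriv a b \<mu> (Suc m) q) (at q)"
proof -
  have sp: "space \<mu> = {0<..}"
    using sets_eq_imp_space_eq[OF sets] by (simp add: space_restrict_space)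
  have id [measurable]: "(\<lambda>x. x) \<in> borel_measurable \<mu>"
    using sets by (simp add: measurable_restrict_space1 cong: measurable_cong_sets)
  have meas: "levy_kernel_deriv m t \<in> borel_measurable \<mu>" for m t
    unfolding levy_kernel_deriv_def by measurable
  let ?S = "{q / 2<..<q + 1}"
  have dom: "\<exists>C>0. \<forall>t\<in>?S. \<forall>x\<in>space \<mu>. \<bar>levy_kernel_deriv m t x\<bar> \<le> C * min x 1" if m: "m \<ge> 1" for m
  proof -
    obtain C where "C > 0"
      "\<And>t x. q / 2 < t \<Longrightarrow> t < q + 1 \<Longrightarrow> 0 < x \<Longrightarrow> \<bar>levy_kernel_deriv m t x\<bar> \<le> C * min x 1"
      by (rule levy_kernel_deriv_bound[of "q / 2" m "q + 1"]) (use q m in auto)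
    then show ?thesis by (intro exI[of _ C]) (auto simp: sp)
  qed
  have int: "integrable \<mu> (levy_kernel_deriv m t)" if "t \<in> ?S" for m t
  proof (cases "m = 0")
    case True
    then show ?thesis using ker[of t] that q by (simp add: levy_kernel_deriv_0)
  next
    case False
    then obtain C where C: "C > 0" "\<forall>t\<in>?S. \<forall>x\<in>space \<mu>. \<bar>levy_kernel_deriv m t x\<bar> \<le> C * min x 1"
      using dom[of m] by auto
    show ?thesis
    proof (rule Bochner_Integration.integrable_bound[OF integrable_mult_right[OF min, of C] meas AE_I2])
      fix x assume "x \<in> space \<mu>"
      then show "norm (levy_kernel_deriv m t x) \<le> norm (C * min x 1)"
        using C that by (fastforce simp: sp)
    qed
  qed
  obtain C where C: "C > 0" "\<forall>t\<in>?S. \<forall>x\<in>space \<mu>. \<bar>levy_kernel_deriv (Suc m) t x\<bar> \<le> C * min x 1"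
    using dom[of "Suc m"] by auto
  have "((\<lambda>t. \<integral>x. levy_kernel_deriv m t x \<partial>\<mu>) has_real_derivative (\<integral>x. levy_kernel_deriv (Suc m) q x \<partial>\<mu>)) (at q)"
  proof (rule has_real_derivative_integral[of ?S])
    show "integrable \<mu> (\<lambda>x. C * min x 1)" using min by (rule integrable_mult_right)
  qed (use q C int meas levy_kernel_deriv_has_derivative in auto)
  moreover have "((\<lambda>q. if m = 0 then 1 / 2 * a * q\<^sup>2 + b * q else if m = 1 then a * q + b else if m = 2 then a else 0)
      has_real_derivative (if Suc m = 0 then 1 / 2 * a * q\<^sup>2 + b * q else if Suc m = 1 then a * q + b else if Suc m = 2 then a else 0)) (at q)"
    by (cases "m = 0"; cases "m = 1"; cases "m = 2") (auto intro!: derivative_eq_intros)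
  ultimately show ?thesis
    unfolding Levy_Psi_deriv_def by (intro DERIV_add)
qed

section \<open>Convergence of the derivatives\<close>

text \<open>
  A monotone derivative at \<open>q\<close> lies between the difference quotients over \<open>[q - s, q]\<close> and
  \<open>[q, q + s]\<close>. These converge in \<open>k\<close>, and their limits are close to \<open>g'\<close> for small \<open>s\<close>.
\<close>

lemma deriv_converges_of_mono:
  fixes f f' :: "nat \<Rightarrow> real \<Rightarrow> real"
  assumes r: "0 < r"
    and D: "\<forall>\<^sub>F k in sequentially. \<forall>t\<in>{q - r<..<q + r}. (f k has_real_derivative f' k t) (at t)"
    and mono: "\<forall>\<^sub>F k in sequentially. mono_on {q - r<..<q + r} (f' k)"
    and lim: "\<And>t. t \<in> {q - r<..<q + r} \<Longrightarrow> (\<lambda>k. f k t) \<longlonglongrightarrow> g t"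
    and g: "(g has_real_derivative g') (at q)"
  shows "(\<lambda>k. f' k q) \<longlonglongrightarrow> g'"
proof (rule LIMSEQ_I)
  fix e :: real assume "e > 0"
  have "((\<lambda>t. (g t - g q) / (t - q)) \<longlongrightarrow> g') (at q)"
    using g by (simp add: has_field_derivative_iff)
  then have "\<forall>\<^sub>F t in at q. dist ((g t - g q) / (t - q)) g' < e / 2"
    by (rule tendstoD) (use \<open>e > 0\<close> in simp)
  then obtain d where d: "d > 0"
    "\<And>t. t \<noteq> q \<Longrightarrow> dist t q < d \<Longrightarrow> dist ((g t - g q) / (t - q)) g' < e / 2"
    by (auto simp: eventually_at)
  define s where "s = min (d / 2) (r / 2)"
  have s: "0 < s" "s < d" "s < r" using d r by (auto simp: s_def min_def)
  have up: "\<bar>(g (q + s) - g q) / s - g'\<bar> < e / 2"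
    using d(2)[of "q + s"] s by (simp add: dist_real_def)
  have lo: "\<bar>(g q - g (q - s)) / s - g'\<bar> < e / 2"
  proof -
    have "(g (q - s) - g q) / (q - s - q) = (g q - g (q - s)) / s"
      using minus_divide_divide[of "g q - g (q - s)" s] by simp
    then show ?thesis using d(2)[of "q - s"] s by (simp add: dist_real_def)
  qed
  have "(\<lambda>k. (f k (q + s) - f k q) / s) \<longlonglongrightarrow> (g (q + s) - g q) / s"
    using s by (intro tendsto_intros lim) auto
  then have U: "\<forall>\<^sub>F k in sequentially. dist ((f k (q + s) - f k q) / s) ((g (q + s) - g q) / s) < e / 2"
    by (rule tendstoD) (use \<open>e > 0\<close> in simp)
  have "(\<lambda>k. (f k q - f k (q - s)) / s) \<longlonglongrightarrow> (g q - g (q - s)) / s"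
    using s by (intro tendsto_intros lim) auto
  then have L: "\<forall>\<^sub>F k in sequentially. dist ((f k q - f k (q - s)) / s) ((g q - g (q - s)) / s) < e / 2"
    by (rule tendstoD) (use \<open>e > 0\<close> in simp)
  have "\<forall>\<^sub>F k in sequentially. norm (f' k q - g') < e"
    using U L D mono
  proof eventually_elim
    case (elim k)
    obtain z where z: "q < z" "z < q + s" "f k (q + s) - f k q = (q + s - q) * f' k z"
      using MVT2[of q "q + s" "f k" "f' k"] elim(3) s by auto
    obtain w where w: "q - s < w" "w < q" "f k q - f k (q - s) = (q - (q - s)) * f' k w"
      using MVT2[of "q - s" q "f k" "f' k"] elim(3) s by auto
    have "f' k q \<le> f' k z" "f' k w \<le> f' k q"
      using z w s by (auto intro!: mono_onD[OF elim(4)])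
    moreover have "(f k (q + s) - f k q) / s = f' k z" "(f k q - f k (q - s)) / s = f' k w"
      using z w s by (auto simp: field_simps)
    ultimately show ?case
      using elim(1,2) up lo unfolding dist_real_def real_norm_def by linarith
  qed
  then show "\<exists>no. \<forall>k\<ge>no. norm (f' k q - g') < e"
    by (simp add: eventually_sequentially)
qed

text \<open>
  Around each point of \<open>K\<close> choose an interval on which \<open>g\<close> is almost constant. For
  monotone functions closeness at its two end points implies closeness in between, and
  finitely many intervals cover \<open>K\<close>.
\<close>

lemma uniform_limit_of_mono:
  fixes f :: "nat \<Rightarrow> real \<Rightarrow> real"
  assumes "open S" "compact K" "K \<subseteq> S"
    and mono: "\<And>a b. {a..b} \<subseteq> S \<Longrightarrow> \<forall>\<^sub>F k in sequentially. mono_on {a..b} (f k)"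
    and lim: "\<And>t. t \<in> S \<Longrightarrow> (\<lambda>k. f k t) \<longlonglongrightarrow> g t"
    and cont: "continuous_on S g"
  shows "uniform_limit K f g sequentially"
proof (rule uniform_limitI)
  fix e :: real assume e: "e > 0"
  have "\<exists>d>0. {x - d..x + d} \<subseteq> S \<and> (\<forall>y\<in>{x - d..x + d}. \<bar>g y - g x\<bar> < e / 4)" if "x \<in> K" for x
  proof -
    have x: "x \<in> S" using that assms by auto
    obtain r where r: "r > 0" "ball x r \<subseteq> S" using \<open>open S\<close> x open_contains_ball by blast
    have "isCont g x" using cont \<open>open S\<close> x by (simp add: continuous_on_eq_continuous_at)
    then obtain d where d: "d > 0" "\<And>y. dist y x < d \<Longrightarrow> dist (g y) (g x) < e / 4"
      unfolding continuous_at_eps_delta using e by (metis divide_pos_pos zero_less_numeral)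
    define s where "s = min d r / 2"
    have s: "0 < s" "s < d" "s < r" using r d by (auto simp: s_def)
    show ?thesis
    proof (intro exI[of _ s] conjI subsetI ballI)
      fix y assume y: "y \<in> {x - s..x + s}"
      then have "\<bar>y - x\<bar> \<le> s" unfolding abs_le_iff by auto
      with s have "dist x y < r" "dist y x < d" by (simp_all add: dist_real_def abs_minus_commute)
      then show "y \<in> S" "\<bar>g y - g x\<bar> < e / 4"
        using r(2) d(2)[of y] by (auto simp: dist_real_def)
    qed (use s in simp)
  qed
  then obtain d where d: "\<And>x. x \<in> K \<Longrightarrow> d x > 0" "\<And>x. x \<in> K \<Longrightarrow> {x - d x..x + d x} \<subseteq> S"
    "\<And>x y. x \<in> K \<Longrightarrow> y \<in> {x - d x..x + d x} \<Longrightarrow> \<bar>g y - g x\<bar> < e / 4"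
    by metis
  have "K \<subseteq> (\<Union>x\<in>K. {x - d x<..<x + d x})" using d(1) by force
  then obtain C where C: "C \<subseteq> K" "finite C" "K \<subseteq> (\<Union>x\<in>C. {x - d x<..<x + d x})"
    using compactE_image[OF \<open>compact K\<close>, of K "\<lambda>x. {x - d x<..<x + d x}"] by auto
  have "\<forall>\<^sub>F k in sequentially. \<forall>x\<in>C. mono_on {x - d x..x + d x} (f k) \<and>
      dist (f k (x - d x)) (g (x - d x)) < e / 4 \<and> dist (f k (x + d x)) (g (x + d x)) < e / 4"
  proof (intro eventually_ball_finite ballI \<open>finite C\<close> eventually_conj)
    fix x assume "x \<in> C"
    then have x: "x \<in> K" using C by auto
    have "x - d x \<in> S" "x + d x \<in> S" using d(1,2)[OF x] by auto
    then show "\<forall>\<^sub>F k in sequentially. dist (f k (x - d x)) (g (x - d x)) < e / 4"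
      "\<forall>\<^sub>F k in sequentially. dist (f k (x + d x)) (g (x + d x)) < e / 4"
      by (intro tendstoD lim; use e in simp)+
    show "\<forall>\<^sub>F k in sequentially. mono_on {x - d x..x + d x} (f k)"
      by (rule mono[OF d(2)[OF x]])
  qed
  then show "\<forall>\<^sub>F k in sequentially. \<forall>y\<in>K. dist (f k y) (g y) < e"
  proof eventually_elim
    case (elim k)
    show ?case
    proof
      fix y assume "y \<in> K"
      then obtain x where x: "x \<in> C" "x - d x < y" "y < x + d x" using C by auto
      then have xK: "x \<in> K" using C by auto
      note el = elim[rule_format, OF x(1)]
      have "f k (x - d x) \<le> f k y" "f k y \<le> f k (x + d x)"
        using x by (auto intro!: mono_onD[OF el[THEN conjunct1]])
      moreover have "\<bar>g y - g x\<bar> < e / 4" "\<bar>g (x - d x) - g x\<bar> < e / 4" "\<bar>g (x + d x) - g x\<bar> < e / 4"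
        using x d(1)[OF xK] d(3)[OF xK, of y] d(3)[OF xK, of "x - d x"] d(3)[OF xK, of "x + d x"]
        by auto
      ultimately show "dist (f k y) (g y) < e"
        using el unfolding dist_real_def by linarith
    qed
  qed
qed

text \<open>
  By the sign condition \<open>(- 1) ^ m\<close> times the derivative of order \<open>m + 1\<close> is increasing for
  every \<open>m\<close>. So pointwise convergence passes from order \<open>m\<close> to order \<open>m + 1\<close>, and at
  every order from the first on it is locally uniform. The intervals \<open>(0, B)\<close> take the
  place of \<open>(0,\<infinity>)\<close> because \<open>Psi_breve\<close> is controlled only on an interval that grows
  with \<open>k\<close>.
\<close>

lemma derivatives_converge:
  fixes F :: "nat \<Rightarrow> nat \<Rightarrow> real \<Rightarrow> real" and G :: "nat \<Rightarrow> real \<Rightarrow> real"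
  assumes F: "\<And>B. \<forall>\<^sub>F k in sequentially. \<forall>m. \<forall>q\<in>{0<..<B}. (F k m has_real_derivative F k (Suc m) q) (at q)"
    and sign: "\<And>B. \<forall>\<^sub>F k in sequentially. \<forall>m\<ge>2. \<forall>q\<in>{0<..<B}. 0 \<le> (- 1) ^ m * F k m q"
    and G: "\<And>m q. q > 0 \<Longrightarrow> (G m has_real_derivative G (Suc m) q) (at q)"
    and lim: "\<And>q. q > 0 \<Longrightarrow> (\<lambda>k. F k 0 q) \<longlonglongrightarrow> G 0 q"
  shows "q > 0 \<Longrightarrow> (\<lambda>k. F k m q) \<longlonglongrightarrow> G m q"
    and "compact K \<Longrightarrow> K \<subseteq> {0<..} \<Longrightarrow> uniform_limit K (\<lambda>k. F k (Suc m)) (G (Suc m)) sequentially"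
proof -
  have mono: "\<forall>\<^sub>F k in sequentially. mono_on {0<..<B} (\<lambda>q. (- 1) ^ m * F k (Suc m) q)" for B m
    using F[of B] sign[of B]
  proof eventually_elim
    case (elim k)
    show ?case
    proof (rule mono_onI)
      fix s t assume st: "s \<in> {0<..<B}" "t \<in> {0<..<B}" "s \<le> t"
      show "(- 1) ^ m * F k (Suc m) s \<le> (- 1) ^ m * F k (Suc m) t"
      proof (rule DERIV_nonneg_imp_nondecreasing[OF st(3)])
        fix x assume "s \<le> x" "x \<le> t"
        then have x: "x \<in> {0<..<B}" using st by auto
        then have "((\<lambda>q. (- 1) ^ m * F k (Suc m) q) has_real_derivative (- 1) ^ m * F k (Suc (Suc m)) x) (at x)"
          using elim(1) by (intro DERIV_cmult) auto
        moreover have "0 \<le> (- 1) ^ m * F k (Suc (Suc m)) x"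
          using elim(2)[rule_format, of "Suc (Suc m)" x] x by simp
        ultimately show "\<exists>y. ((\<lambda>q. (- 1) ^ m * F k (Suc m) q) has_real_derivative y) (at x) \<and> 0 \<le> y"
          by blast
      qed
    qed
  qed
  have pw: "(\<lambda>k. F k m q) \<longlonglongrightarrow> G m q" if "q > 0" for m q
    using that
  proof (induction m arbitrary: q)
    case 0
    then show ?case by (rule lim)
  next
    case (Suc m)
    have "(\<lambda>k. (- 1) ^ m * F k (Suc m) q) \<longlonglongrightarrow> (- 1) ^ m * G (Suc m) q"
    proof (rule deriv_converges_of_mono[OF Suc.prems, where q = q
          and f = "\<lambda>k t. (- 1) ^ m * F k m t" and f' = "\<lambda>k t. (- 1) ^ m * F k (Suc m) t"
          and g = "\<lambda>t. (- 1) ^ m * G m t"])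
      show "\<forall>\<^sub>F k in sequentially. \<forall>t\<in>{q - q<..<q + q}.
          ((\<lambda>t. (- 1) ^ m * F k m t) has_real_derivative (- 1) ^ m * F k (Suc m) t) (at t)"
        using F[of "q + q"] by eventually_elim (auto intro!: DERIV_cmult)
      show "\<forall>\<^sub>F k in sequentially. mono_on {q - q<..<q + q} (\<lambda>t. (- 1) ^ m * F k (Suc m) t)"
        using mono[of "q + q" m] by simp
      show "(\<lambda>k. (- 1) ^ m * F k m t) \<longlonglongrightarrow> (- 1) ^ m * G m t" if "t \<in> {q - q<..<q + q}" for t
        using Suc.IH[of t] that by (intro tendsto_intros) auto
      show "((\<lambda>t. (- 1) ^ m * G m t) has_real_derivative (- 1) ^ m * G (Suc m) q) (at q)"
        using G[OF Suc.prems] by (rule DERIV_cmult)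
    qed
    then have "(\<lambda>k. (- 1) ^ m * ((- 1) ^ m * F k (Suc m) q)) \<longlonglongrightarrow> (- 1) ^ m * ((- 1) ^ m * G (Suc m) q)"
      by (rule tendsto_mult_left)
    then show ?case by (simp flip: mult.assoc power_mult_distrib)
  qed
  then show "q > 0 \<Longrightarrow> (\<lambda>k. F k m q) \<longlonglongrightarrow> G m q" .
  assume K: "compact K" "K \<subseteq> {0<..}"
  have "uniform_limit K (\<lambda>k t. (- 1) ^ m * F k (Suc m) t) (\<lambda>t. (- 1) ^ m * G (Suc m) t) sequentially"
  proof (rule uniform_limit_of_mono[of "{0<..}", OF _ K])
    show "\<forall>\<^sub>F k in sequentially. mono_on {a..b} (\<lambda>t. (- 1) ^ m * F k (Suc m) t)"
      if "{a..b} \<subseteq> {0<..}" for a b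
    proof -
      have sub: "{a..b} \<subseteq> {0<..<b + 1}"
      proof
        fix x assume x: "x \<in> {a..b}"
        then have "x \<in> {0<..}" using that by blast
        then show "x \<in> {0<..<b + 1}" using x by auto
      qed
      show ?thesis
        using mono[of "b + 1" m] by eventually_elim (rule mono_on_subset[OF _ sub])
    qed
    show "(\<lambda>k. (- 1) ^ m * F k (Suc m) t) \<longlonglongrightarrow> (- 1) ^ m * G (Suc m) t" if "t \<in> {0<..}" for t
      using pw that by (intro tendsto_intros) auto
    show "continuous_on {0<..} (\<lambda>t. (- 1) ^ m * G (Suc m) t)"
      using G[of _ "Suc m"] by (intro continuous_intros continuous_at_imp_continuous_on)
         (auto intro: DERIV_isCont)
  qed simp
  then have "uniform_limit K (\<lambda>k t. (- 1) ^ m * ((- 1) ^ m * F k (Suc m) t))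
     (\<lambda>t. (- 1) ^ m * ((- 1) ^ m * G (Suc m) t)) sequentially"
    by (rule bounded_linear.uniform_limit[OF bounded_linear_mult_right])
  then show "uniform_limit K (\<lambda>k. F k (Suc m)) (G (Suc m)) sequentially"
    by (simp flip: mult.assoc power_mult_distrib)
qed

section \<open>Representing limits of integrals by a measure\<close>

text \<open>
  The map \<open>x \<mapsto> exp (- x)\<close> identifies \<open>[0,\<infinity>]\<close> with \<open>[0,1]\<close>, where Helly's theorem and
  Weierstrass approximation are available. Its inverse is extended continuously to all of
  \<open>\<real>\<close>, because weak convergence on \<open>\<real>\<close> is tested by functions on \<open>\<real>\<close>: it is constant
  on each side of \<open>[0,1]\<close>, beyond \<open>1\<close> because \<open>ennreal\<close> sends negative numbers to \<open>0\<close>.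
\<close>

definition neg_log :: "real \<Rightarrow> ennreal" where
  "neg_log u = (if u \<le> 0 then top else ennreal (- ln u))"

definition exp_neg :: "ennreal \<Rightarrow> real" where
  "exp_neg = extend_ennreal 1 0 (\<lambda>x. exp (- x))"

lemma exp_neg_simps [simp]:
  "exp_neg 0 = 1" "exp_neg top = 0" "x > 0 \<Longrightarrow> exp_neg (ennreal x) = exp (- x)"
  by (auto simp: exp_neg_def)

lemma continuous_on_exp_neg: "continuous_on UNIV exp_neg"
proof -
  have "((\<lambda>x::real. exp (- x)) \<longlongrightarrow> 1) (at_right 0)" "((\<lambda>x::real. exp (- x)) \<longlongrightarrow> 0) at_top"
    by real_asymp+
  then show ?thesis
    unfolding exp_neg_def by (intro continuous_on_extend_ennreal continuous_intros)
qed

lemma exp_neg_range: "exp_neg x \<in> {0..1}"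
  by (cases x rule: ennreal_exhaust_three) auto

lemma neg_log_exp_neg [simp]: "neg_log (exp_neg x) = x"
  by (cases x rule: ennreal_exhaust_three) (auto simp: neg_log_def)

lemma continuous_on_neg_log: "continuous_on UNIV neg_log"
proof -
  have "(neg_log \<longlongrightarrow> neg_log u) (nhds u)" for u
  proof (cases "u > 0")
    case True
    have "((\<lambda>v. ennreal (- ln v)) \<longlongrightarrow> ennreal (- ln u)) (nhds u)"
      using True by (intro tendsto_intros) (auto simp: filterlim_ident)
    moreover have "\<forall>\<^sub>F v in nhds u. ennreal (- ln v) = neg_log v"
      using eventually_nhds_in_open[of "{0<..}" u] True
      by (auto simp: neg_log_def elim: eventually_mono)
    ultimately show ?thesis
      using True by (auto simp: neg_log_def[of u] intro: Lim_transform_eventually)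
  next
    case False
    have "\<forall>\<^sub>F v in nhds u. ennreal l < neg_log v" if "l \<ge> 0" for l
    proof -
      have "\<forall>\<^sub>F v in nhds u. v < exp (- l)"
        using eventually_nhds_in_open[of "{..<exp (- l)}" u] False
          le_less_trans[of u 0 "exp (- l)"] by simp
      then show ?thesis
      proof eventually_elim
        case (elim v)
        have "l < - ln v" if "v > 0"
          using elim that ln_less_cancel_iff[of v "exp (- l)"] by simp
        then show ?case using \<open>l \<ge> 0\<close> by (auto simp: neg_log_def ennreal_less_iff)
      qed
    qed
    then show ?thesis using False by (simp add: neg_log_def[of u] tendsto_top_iff_ennreal)
  qed
  then show ?thesis
    by (auto simp: continuous_on_def intro: tendsto_mono[OF at_within_le_nhds])
qed

lemma integrable_continuous_ennreal:
  fixes g :: "ennreal \<Rightarrow> real"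
  assumes "finite_measure M" "sets M = sets borel" "continuous_on UNIV g"
  shows "integrable M g"
proof -
  obtain B where "\<And>x. \<bar>g x\<bar> \<le> B" using bounded_continuous_ennreal[OF assms(3)] by blast
  moreover have "g \<in> borel_measurable M"
    using assms(2) borel_measurable_continuous_onI[OF assms(3)] by (simp cong: measurable_cong_sets)
  ultimately show ?thesis
    using assms(1) by (intro finite_measure.integrable_const_bound[where B = B]) auto
qed

text \<open>
  The normalised images of the measures under \<open>exp_neg\<close> are probability measures on
  \<open>[0,1]\<close>, hence tight, and a subsequence converges weakly. Along the full sequence the
  integrals converge by assumption, so the subsequential limit represents them.
  Normalisation requires a positive limit mass; otherwise the null measure is the limit.
\<close>

lemma weak_star_limit_exists:
  fixes M :: "nat \<Rightarrow> ennreal measure"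
  assumes fin: "\<And>k. finite_measure (M k)" and sets: "\<And>k. sets (M k) = sets borel"
    and conv: "\<And>g :: ennreal \<Rightarrow> real. continuous_on UNIV g \<Longrightarrow> convergent (\<lambda>k. \<integral>x. g x \<partial>M k)"
  shows "\<exists>\<kappa>. finite_measure \<kappa> \<and> sets \<kappa> = sets borel \<and> weak_star_conv M \<kappa>"
proof -
  define m where "m k = measure (M k) UNIV" for k
  have sp: "space (M k) = UNIV" for k using sets_eq_imp_space_eq[OF sets] by simp
  have "convergent m"
    using conv[of "\<lambda>_. 1"] by (simp add: m_def[abs_def] sp)
  then obtain m0 where m0: "m \<longlonglongrightarrow> m0" by (auto simp: convergent_def)
  have "m0 \<ge> 0" using m0 by (rule LIMSEQ_le_const) (auto simp: m_def)
  show ?thesis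
  proof (cases "m0 = 0")
    case True
    have "(\<lambda>k. \<integral>x. g x \<partial>M k) \<longlonglongrightarrow> 0" if g: "continuous_on UNIV g" for g :: "ennreal \<Rightarrow> real"
    proof -
      obtain B where B: "\<And>x. \<bar>g x\<bar> \<le> B" using bounded_continuous_ennreal[OF g] by blast
      show ?thesis
      proof (rule Lim_null_comparison)
        show "\<forall>\<^sub>F k in sequentially. norm (\<integral>x. g x \<partial>M k) \<le> B * m k"
        proof (rule always_eventually, rule allI)
          fix k
          have "norm (\<integral>x. g x \<partial>M k) \<le> (\<integral>x. \<bar>g x\<bar> \<partial>M k)"
            using integral_norm_bound[of "M k" g] by simp
          also have "\<dots> \<le> (\<integral>x. B \<partial>M k)"
            using B integrable_continuous_ennreal[OF fin sets g, of k] finite_measure.integrable_const[OF fin]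
            by (intro integral_mono integrable_abs) auto
          also have "\<dots> = B * m k" by (simp add: m_def sp)
          finally show "norm (\<integral>x. g x \<partial>M k) \<le> B * m k" .
        qed
        show "(\<lambda>k. B * m k) \<longlonglongrightarrow> 0" using tendsto_mult_left[OF m0, of B] True by simp
      qed
    qed
    then show ?thesis
      by (intro exI[of _ "null_measure borel"])
         (auto simp: weak_star_conv_def intro!: finite_measureI)
  next
    case False
    with \<open>m0 \<ge> 0\<close> have "m0 > 0" by simp
    then have "\<forall>\<^sub>F k in sequentially. m k > 0"
      using m0 by (intro order_tendstoD) auto
    then obtain N where N: "\<And>k. k \<ge> N \<Longrightarrow> m k > 0" by (auto simp: eventually_sequentially)
    define P where "P k = distr (density (M (k + N)) (\<lambda>_. ennreal (1 / m (k + N)))) borel exp_neg" for k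
    have [measurable]: "exp_neg \<in> borel_measurable borel"
      by (rule borel_measurable_continuous_onI[OF continuous_on_exp_neg])
    have em: "exp_neg \<in> borel_measurable (density (M k) f)" for k f
      using sets by (simp cong: measurable_cong_sets)
    have emd: "emeasure (P k) A = ennreal (1 / m (k + N)) * emeasure (M (k + N)) (exp_neg -` A)"
      if A: "A \<in> sets borel" for k A
    proof -
      have V: "exp_neg -` A \<in> sets (M (k + N))"
        using A measurable_sets[of exp_neg borel borel A] sets by simp
      show ?thesis
        unfolding P_def using A V em
        by (subst emeasure_distr) (auto simp: sp emeasure_density nn_integral_cmult_indicator)
    qed
    have tot: "emeasure (P k) A = 1" if "A \<in> sets borel" "{0..1} \<subseteq> A" for k A
    proof -
      have "exp_neg -` A = UNIV" using that exp_neg_range by blast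
      then show ?thesis
        unfolding emd[OF that(1)] using N[of "k + N"]
        by (simp add: m_def finite_measure.emeasure_eq_measure[OF fin] flip: ennreal_mult)
    qed
    have rd: "real_distribution (P k)" for k
    proof -
      have "space (P k) = UNIV" by (simp add: P_def)
      then have "prob_space (P k)" using tot[of UNIV k] by (intro prob_spaceI) auto
      then show ?thesis
        by (auto simp: real_distribution_def real_distribution_axioms_def P_def)
    qed
    have "tight P"
      unfolding tight_def
    proof (intro conjI allI impI rd)
      fix e :: real assume "e > 0"
      then have "measure (P n) {-1<..1} > 1 - e" for n
      proof -
        have "{0..1} \<subseteq> {-1<..1 :: real}" by auto
        then show ?thesis using tot[of "{-1<..1}" n] \<open>e > 0\<close> by (simp add: measure_def)
      qed
      then show "\<exists>a b. a < b \<and> (\<forall>n. 1 - e < measure (P n) {a<..b})"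
        by (intro exI[of _ "-1"] exI[of _ 1]) auto
    qed
    then obtain r D where r: "strict_mono r" and D: "real_distribution D"
      and wc: "weak_conv_m (P \<circ> r) D"
      using tight_imp_convergent_subsubsequence[of P id] by (auto simp: strict_mono_def)
    interpret D: real_distribution D by fact
    define \<kappa> where "\<kappa> = distr (density D (\<lambda>_. ennreal m0)) borel neg_log"
    have [measurable]: "neg_log \<in> borel_measurable borel"
      by (rule borel_measurable_continuous_onI[OF continuous_on_neg_log])
    have nm: "neg_log \<in> borel_measurable (density D f)" for f by measurable
    have "finite_measure \<kappa>"
      unfolding \<kappa>_def using nm
      by (intro finite_measure.finite_measure_distr finite_measureI)
         (auto simp: emeasure_density nn_integral_cmult_indicator ennreal_mult_eq_top_iff D.emeasure_space_1)
    moreover have "sets \<kappa> = sets borel" by (simp add: \<kappa>_def)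
    moreover have "weak_star_conv M \<kappa>"
      unfolding weak_star_conv_def
    proof (intro allI impI)
      fix g :: "ennreal \<Rightarrow> real" assume g: "continuous_on UNIV g"
      obtain B where B: "\<And>x. \<bar>g x\<bar> \<le> B" using bounded_continuous_ennreal[OF g] by blast
      have gm [measurable]: "g \<in> borel_measurable borel"
        using g by (rule borel_measurable_continuous_onI)
      obtain l where l: "(\<lambda>k. \<integral>x. g x \<partial>M k) \<longlonglongrightarrow> l" using conv[OF g] by (auto simp: convergent_def)
      have gl: "continuous_on UNIV (\<lambda>u. g (neg_log u))"
        by (rule continuous_on_compose2[OF g continuous_on_neg_log]) auto
      have gP: "(\<integral>u. g (neg_log u) \<partial>P k) = (\<integral>x. g x \<partial>M (k + N)) / m (k + N)" for k
      proof -
        have gM: "g \<in> borel_measurable (M (k + N))"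
          using gm sets by (simp cong: measurable_cong_sets)
        have "(\<integral>u. g (neg_log u) \<partial>P k) = (\<integral>x. g x \<partial>density (M (k + N)) (\<lambda>_. ennreal (1 / m (k + N))))"
          unfolding P_def using em by (subst integral_distr) auto
        also have "\<dots> = (\<integral>x. (1 / m (k + N)) *\<^sub>R g x \<partial>M (k + N))"
          using gM N[of "k + N"] by (intro integral_density) auto
        finally show ?thesis by simp
      qed
      have "(\<lambda>n. \<integral>u. g (neg_log u) \<partial>(P \<circ> r) n) \<longlonglongrightarrow> (\<integral>u. g (neg_log u) \<partial>D)"
        by (rule weak_conv_imp_integral_bdd_continuous_conv[OF _ D wc, where B = B])
           (use gl B rd in \<open>auto simp: continuous_on_eq_continuous_at\<close>)
      moreover have "(\<lambda>k. (\<integral>x. g x \<partial>M (k + N)) / m (k + N)) \<longlonglongrightarrow> l / m0"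
        using LIMSEQ_ignore_initial_segment[OF l, of N] LIMSEQ_ignore_initial_segment[OF m0, of N] False
        by (intro tendsto_divide) auto
      then have "((\<lambda>k. (\<integral>x. g x \<partial>M (k + N)) / m (k + N)) \<circ> r) \<longlonglongrightarrow> l / m0"
        by (rule LIMSEQ_subseq_LIMSEQ[OF _ r])
      ultimately have "(\<integral>u. g (neg_log u) \<partial>D) = l / m0"
        by (auto simp: gP o_def intro: LIMSEQ_unique)
      moreover have "(\<integral>x. g x \<partial>\<kappa>) = m0 * (\<integral>u. g (neg_log u) \<partial>D)"
      proof -
        have "(\<integral>x. g x \<partial>\<kappa>) = (\<integral>u. g (neg_log u) \<partial>density D (\<lambda>_. ennreal m0))"
          unfolding \<kappa>_def using nm by (subst integral_distr) auto
        also have "\<dots> = (\<integral>u. m0 *\<^sub>R g (neg_log u) \<partial>D)"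
          using \<open>m0 > 0\<close> by (intro integral_density) auto
        finally show ?thesis by simp
      qed
      ultimately show "(\<lambda>k. \<integral>x. g x \<partial>M k) \<longlonglongrightarrow> (\<integral>x. g x \<partial>\<kappa>)"
        using l False by simp
    qed
    ultimately show ?thesis by blast
  qed
qed

section \<open>Density of the test functions\<close>

lemma convergent_integral_uniform_approx:
  fixes M :: "nat \<Rightarrow> ennreal measure" and g :: "ennreal \<Rightarrow> real"
  assumes fin: "\<And>k. finite_measure (M k)" and sets: "\<And>k. sets (M k) = sets borel"
    and mass: "\<forall>\<^sub>F k in sequentially. measure (M k) UNIV \<le> C"
    and g: "continuous_on UNIV g"
    and approx: "\<And>e. e > 0 \<Longrightarrow> \<exists>f. continuous_on UNIV f \<and> (\<forall>x. \<bar>g x - f x\<bar> \<le> e) \<and>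
      convergent (\<lambda>k. \<integral>x. f x \<partial>M k)"
  shows "convergent (\<lambda>k. \<integral>x. g x \<partial>M k)"
proof -
  have sp: "space (M k) = UNIV" for k using sets_eq_imp_space_eq[OF sets] by simp
  have "Cauchy (\<lambda>k. \<integral>x. g x \<partial>M k)"
  proof (rule CauchyI)
    fix e :: real assume e: "e > 0"
    define e' where "e' = e / (4 * (\<bar>C\<bar> + 1))"
    have e': "e' > 0" "e' * \<bar>C\<bar> \<le> e / 4" using e by (auto simp: e'_def field_simps)
    obtain f where f: "continuous_on UNIV f" "\<And>x. \<bar>g x - f x\<bar> \<le> e'"
      "convergent (\<lambda>k. \<integral>x. f x \<partial>M k)" using approx[OF e'(1)] by blast
    have close: "\<bar>(\<integral>x. g x \<partial>M k) - (\<integral>x. f x \<partial>M k)\<bar> \<le> e / 4" if "measure (M k) UNIV \<le> C" for k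
    proof -
      note I = integrable_continuous_ennreal[OF fin sets]
      have "\<bar>(\<integral>x. g x \<partial>M k) - (\<integral>x. f x \<partial>M k)\<bar> = \<bar>\<integral>x. g x - f x \<partial>M k\<bar>"
        using I[OF g] I[OF f(1)] by simp
      also have "\<dots> \<le> (\<integral>x. \<bar>g x - f x\<bar> \<partial>M k)" by (rule integral_abs_bound)
      also have "\<dots> \<le> (\<integral>x. e' \<partial>M k)"
        using I[OF g] I[OF f(1)] f(2) finite_measure.integrable_const[OF fin]
        by (intro integral_mono integrable_abs Bochner_Integration.integrable_diff) auto
      also have "\<dots> = e' * measure (M k) UNIV" by (simp add: sp)
      also have "\<dots> \<le> e' * \<bar>C\<bar>" using that e' by (intro mult_left_mono) auto
      finally show ?thesis using e' by linarith
    qed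
    obtain N1 where N1: "\<And>k. k \<ge> N1 \<Longrightarrow> measure (M k) UNIV \<le> C"
      using mass by (auto simp: eventually_sequentially)
    have "Cauchy (\<lambda>k. \<integral>x. f x \<partial>M k)" using f(3) by (rule convergent_Cauchy)
    then obtain N2 where N2: "\<And>i j. i \<ge> N2 \<Longrightarrow> j \<ge> N2 \<Longrightarrow> \<bar>(\<integral>x. f x \<partial>M i) - (\<integral>x. f x \<partial>M j)\<bar> < e / 4"
      using e by (metis CauchyD real_norm_def zero_less_divide_iff zero_less_numeral)
    show "\<exists>N. \<forall>i\<ge>N. \<forall>j\<ge>N. norm ((\<integral>x. g x \<partial>M i) - (\<integral>x. g x \<partial>M j)) < e"
    proof (intro exI[of _ "max N1 N2"] allI impI)
      fix i j assume ij: "max N1 N2 \<le> i" "max N1 N2 \<le> j"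
      have "\<bar>(\<integral>x. f x \<partial>M i) - (\<integral>x. f x \<partial>M j)\<bar> < e / 4" using N2[of i j] ij by simp
      moreover have "\<bar>(\<integral>x. g x \<partial>M i) - (\<integral>x. f x \<partial>M i)\<bar> \<le> e / 4"
        "\<bar>(\<integral>x. g x \<partial>M j) - (\<integral>x. f x \<partial>M j)\<bar> \<le> e / 4"
        using close N1 ij by auto
      ultimately show "norm ((\<integral>x. g x \<partial>M i) - (\<integral>x. g x \<partial>M j)) < e"
        unfolding real_norm_def using e by linarith
    qed
  qed
  then show ?thesis by (rule Cauchy_convergent)
qed

text \<open>
  The second difference of \<open>levy_test q x\<close> in \<open>q\<close> at \<open>q = 0, 1, 2\<close>, where
  \<open>levy_test 0 = 0\<close>. On \<open>(0,\<infinity>)\<close> it is \<open>(1 - exp (- x))\<^sup>2 / (x min x 1)\<close>.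
\<close>

definition second_difference :: "ennreal \<Rightarrow> real" where
  "second_difference x = levy_test 2 x - 2 * levy_test 1 x"

text \<open>
  Second differences in \<open>q\<close> remove the affine part \<open>q x - 1\<close> of the kernel, and those of
  \<open>exp (- q x)\<close> are geometric in \<open>q\<close>.
\<close>

lemma second_difference_shift:
  "levy_test (real n + 2) x - 2 * levy_test (real n + 1) x + levy_test (real n) x
    = exp_neg x ^ n * second_difference x"
proof (cases x rule: ennreal_exhaust_three)
  case 1
  then show ?thesis by (simp add: second_difference_def power2_eq_square field_simps)
next
  case (2 r)
  define u where "u = exp (- r)"
  have u: "exp (- (c * r)) = exp (- c * r)" "exp (- (real n) * r) = u ^ n"
    "exp (- (real n + 1) * r) = u ^ n * u" "exp (- (real n + 2) * r) = u ^ n * u * u"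
    "exp (- 1 * r) = u" "exp (- 2 * r) = u * u" for c
    by (simp_all add: u_def algebra_simps flip: exp_add exp_of_nat_mult)
  have "levy_kernel (real n + 2) r - 2 * levy_kernel (real n + 1) r + levy_kernel (real n) r
      = u ^ n * (levy_kernel 2 r - 2 * levy_kernel 1 r)"
    unfolding levy_kernel_def u using 2 by (simp add: field_simps)
  then have "(levy_kernel (real n + 2) r - 2 * levy_kernel (real n + 1) r + levy_kernel (real n) r) / min r 1
      = u ^ n * (levy_kernel 2 r - 2 * levy_kernel 1 r) / min r 1" by simp
  then show ?thesis using 2
    by (simp add: second_difference_def u_def diff_divide_distrib add_divide_distrib right_diff_distrib)
next
  case 3
  then show ?thesis by (cases n) (auto simp: second_difference_def)
qed

lemma continuous_on_second_difference: "continuous_on UNIV second_difference"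
  unfolding second_difference_def by (intro continuous_intros continuous_on_levy_test) auto

lemma second_difference_nonzero: "x \<noteq> top \<Longrightarrow> second_difference x \<noteq> 0"
proof (cases x rule: ennreal_exhaust_three)
  case (2 r)
  have "exp (- 2 * r) = exp (- r) * exp (- r)" by (simp flip: exp_add)
  then have "levy_kernel 2 r - 2 * levy_kernel 1 r = (1 - exp (- r))\<^sup>2 / r"
    using 2 by (simp add: levy_kernel_def power2_eq_square field_simps)
  moreover have "1 - exp (- r) \<noteq> 0" using 2 by simp
  ultimately have "levy_kernel 2 r - 2 * levy_kernel 1 r \<noteq> 0" using 2 by simp
  moreover have "second_difference x = (levy_kernel 2 r - 2 * levy_kernel 1 r) / min r 1"
    using 2 by (simp add: second_difference_def diff_divide_distrib)
  ultimately show ?thesis using 2 by simp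
qed (auto simp: second_difference_def)

text \<open>
  Write \<open>R\<close> for \<open>second_difference\<close>. The class of \<open>g\<close> with convergent integrals is linear
  and, by the bounded masses, closed under uniform limits. It contains \<open>exp_neg ^ n R\<close>,
  hence \<open>f R\<close> for all continuous \<open>f\<close> by Weierstrass approximation, hence every continuous
  function that vanishes at \<open>\<infinity>\<close>, the only zero of \<open>R\<close>. Subtracting \<open>g(\<infinity>) levy_test 1\<close>
  makes \<open>g\<close> vanish there, because \<open>levy_test 1\<close> has the value \<open>1\<close> at \<open>\<infinity>\<close>.
\<close>

lemma levy_tests_determine_limit:
  fixes M :: "nat \<Rightarrow> ennreal measure" and g :: "ennreal \<Rightarrow> real"
  assumes fin: "\<And>k. finite_measure (M k)" and sets: "\<And>k. sets (M k) = sets borel"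
    and mass: "\<forall>\<^sub>F k in sequentially. measure (M k) UNIV \<le> C"
    and conv: "\<And>q. q \<ge> 0 \<Longrightarrow> convergent (\<lambda>k. \<integral>x. levy_test q x \<partial>M k)"
    and g: "continuous_on UNIV g"
  shows "convergent (\<lambda>k. \<integral>x. g x \<partial>M k)"
proof -
  note I = integrable_continuous_ennreal[OF fin sets]
  note approx = convergent_integral_uniform_approx[OF fin sets mass]
  let ?R = second_difference
  obtain B where B: "B > 0" "\<And>x. \<bar>?R x\<bar> \<le> B"
    using bounded_continuous_ennreal[OF continuous_on_second_difference] by blast
  have cont_mono: "continuous_on UNIV (\<lambda>x. exp_neg x ^ n * ?R x)" for n
    by (intro continuous_intros continuous_on_exp_neg continuous_on_second_difference)
  have mono: "convergent (\<lambda>k. \<integral>x. exp_neg x ^ n * ?R x \<partial>M k)" for n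
  proof -
    have "(\<integral>x. exp_neg x ^ n * ?R x \<partial>M k) = (\<integral>x. levy_test (real n + 2) x \<partial>M k)
        - 2 * (\<integral>x. levy_test (real n + 1) x \<partial>M k) + (\<integral>x. levy_test (real n) x \<partial>M k)" for k
      unfolding second_difference_shift[symmetric]
      using I[OF continuous_on_levy_test] by simp
    then show ?thesis
      using conv by (auto intro!: convergent_add convergent_diff convergent_mult convergent_const)
  qed
  have poly: "convergent (\<lambda>k. \<integral>x. (\<Sum>i\<le>n. a i * exp_neg x ^ i) * ?R x \<partial>M k)" for n and a :: "nat \<Rightarrow> real"
  proof -
    have "(\<integral>x. (\<Sum>i\<le>n. a i * exp_neg x ^ i) * ?R x \<partial>M k) = (\<Sum>i\<le>n. a i * (\<integral>x. exp_neg x ^ i * ?R x \<partial>M k))" for k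
      using I[OF cont_mono] by (simp add: sum_distrib_right mult.assoc Bochner_Integration.integral_sum)
    then show ?thesis
      using mono by (auto intro!: convergent_sum convergent_mult convergent_const)
  qed
  have mult: "convergent (\<lambda>k. \<integral>x. f x * ?R x \<partial>M k)" if f: "continuous_on UNIV f" for f :: "ennreal \<Rightarrow> real"
  proof (rule approx)
    show "continuous_on UNIV (\<lambda>x. f x * ?R x)"
      by (intro continuous_intros f continuous_on_second_difference)
    fix e :: real assume e: "e > 0"
    have "continuous_on {0..1} (\<lambda>u. f (neg_log u))"
      by (rule continuous_on_compose2[OF f continuous_on_subset[OF continuous_on_neg_log]]) auto
    then obtain p where p: "polynomial_function p" "\<And>u. u \<in> {0..1} \<Longrightarrow> norm (f (neg_log u) - p u) < e / B"
      using Stone_Weierstrass_polynomial_function[of "{0..1::real}" "\<lambda>u. f (neg_log u)" "e / B"] e B by auto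
    obtain a n where a: "p = (\<lambda>u. \<Sum>i\<le>n. a i * u ^ i)"
      using p(1) by (metis real_polynomial_function_eq real_polynomial_function_iff_sum)
    show "\<exists>f'. continuous_on UNIV f' \<and> (\<forall>x. \<bar>f x * ?R x - f' x\<bar> \<le> e) \<and> convergent (\<lambda>k. \<integral>x. f' x \<partial>M k)"
    proof (intro exI[of _ "\<lambda>x. (\<Sum>i\<le>n. a i * exp_neg x ^ i) * ?R x"] conjI allI poly)
      show "continuous_on UNIV (\<lambda>x. (\<Sum>i\<le>n. a i * exp_neg x ^ i) * ?R x)"
        by (intro continuous_intros continuous_on_exp_neg continuous_on_second_difference)
      fix x
      have "\<bar>f x - p (exp_neg x)\<bar> \<le> e / B"
        using p(2)[OF exp_neg_range, of x] by simp
      then have "\<bar>f x - p (exp_neg x)\<bar> * \<bar>?R x\<bar> \<le> e / B * B"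
        using B e by (intro mult_mono) auto
      then show "\<bar>f x * ?R x - (\<Sum>i\<le>n. a i * exp_neg x ^ i) * ?R x\<bar> \<le> e"
        using B by (simp add: a flip: abs_mult left_diff_distrib)
    qed
  qed
  have vanish: "convergent (\<lambda>k. \<integral>x. f x \<partial>M k)" if f: "continuous_on UNIV f" and f0: "f top = 0" for f :: "ennreal \<Rightarrow> real"
  proof (rule approx[OF f])
    fix e :: real assume e: "e > 0"
    obtain A where A: "A > 0" "\<And>x. \<bar>f x\<bar> \<le> A" using bounded_continuous_ennreal[OF f] by blast
    have "\<exists>s>0. \<forall>x. \<bar>f x\<bar> \<ge> e \<longrightarrow> s \<le> (?R x)\<^sup>2"
    proof (cases "{x. e \<le> \<bar>f x\<bar>} = {}")
      case False
      have "closed {x. e \<le> \<bar>f x\<bar>}" using f by (intro closed_Collect_le continuous_intros)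
      then have "compact {x. e \<le> \<bar>f x\<bar>}"
        using compact_UNIV_ennreal compact_Int_closed[of UNIV "{x. e \<le> \<bar>f x\<bar>}"] by simp
      then obtain y where y: "e \<le> \<bar>f y\<bar>" "\<And>x. e \<le> \<bar>f x\<bar> \<Longrightarrow> (?R y)\<^sup>2 \<le> (?R x)\<^sup>2"
        using continuous_attains_inf[of "{x. e \<le> \<bar>f x\<bar>}" "\<lambda>x. (?R x)\<^sup>2"] False
          continuous_on_subset[OF continuous_on_power[OF continuous_on_second_difference]]
        by auto
      have "y \<noteq> top" using y(1) f0 e by auto
      then show ?thesis using second_difference_nonzero y(2) by (intro exI[of _ "(?R y)\<^sup>2"]) auto
    qed (intro exI[of _ 1], auto)
    then obtain s where s: "s > 0" "\<And>x. \<bar>f x\<bar> \<ge> e \<Longrightarrow> s \<le> (?R x)\<^sup>2" by blast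
    define d where "d = e * s / A"
    have d: "d > 0" using e s A by (simp add: d_def)
    have den: "(?R x)\<^sup>2 + d > 0" for x using d by (simp add: add_nonneg_pos)
    \<comment> \<open>The quotient \<open>f / R\<close> may be unbounded at \<open>\<infinity>\<close>; adding \<open>d\<close> regularises it. The error
      is the factor \<open>d / (R\<^sup>2 + d)\<close>, which is small where \<open>R\<^sup>2 \<ge> s\<close>, and elsewhere \<open>f\<close> itself
      is below \<open>e\<close>.\<close>
    define w where "w x = f x * ?R x / ((?R x)\<^sup>2 + d)" for x
    have w: "continuous_on UNIV w"
      unfolding w_def using den
      by (intro continuous_intros f continuous_on_second_difference) (metis less_irrefl)
    show "\<exists>f'. continuous_on UNIV f' \<and> (\<forall>x. \<bar>f x - f' x\<bar> \<le> e) \<and> convergent (\<lambda>k. \<integral>x. f' x \<partial>M k)"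
    proof (intro exI[of _ "\<lambda>x. w x * ?R x"] conjI allI mult[OF w])
      show "continuous_on UNIV (\<lambda>x. w x * ?R x)"
        by (intro continuous_intros w continuous_on_second_difference)
      fix x
      have "f x - w x * ?R x = f x * (d / ((?R x)\<^sup>2 + d))"
        using den[of x] by (simp add: w_def field_simps power2_eq_square)
      then have eq: "\<bar>f x - w x * ?R x\<bar> = \<bar>f x\<bar> * (d / ((?R x)\<^sup>2 + d))"
        using den[of x] d by (simp add: abs_mult)
      show "\<bar>f x - w x * ?R x\<bar> \<le> e"
      proof (cases "e \<le> \<bar>f x\<bar>")
        case True
        have "\<bar>f x\<bar> * (d / ((?R x)\<^sup>2 + d)) \<le> A * (d / s)"
          using A s(2)[OF True] s(1) d by (intro mult_mono frac_le) auto
        also have "\<dots> = e" using A s by (simp add: d_def)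
        finally show ?thesis using eq by simp
      next
        case False
        have "\<bar>f x\<bar> * (d / ((?R x)\<^sup>2 + d)) \<le> \<bar>f x\<bar> * 1"
          using den[of x] d by (intro mult_left_mono) auto
        then show ?thesis using eq False by simp
      qed
    qed
  qed
  have c1: "continuous_on UNIV (levy_test 1)" by (intro continuous_on_levy_test) simp
  \<comment> \<open>Split off the value at \<open>\<infinity>\<close>.\<close>
  have "convergent (\<lambda>k. (\<integral>x. g x - g top * levy_test 1 x \<partial>M k) + g top * (\<integral>x. levy_test 1 x \<partial>M k))"
  proof (rule convergent_add)
    show "convergent (\<lambda>k. \<integral>x. g x - g top * levy_test 1 x \<partial>M k)"
      by (rule vanish) (auto intro!: continuous_on_diff continuous_on_mult g c1)
    show "convergent (\<lambda>k. g top * (\<integral>x. levy_test 1 x \<partial>M k))"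
      by (rule convergent_mult[OF convergent_const]) (simp add: conv)
  qed
  moreover have "(\<integral>x. g x - g top * levy_test 1 x \<partial>M k) + g top * (\<integral>x. levy_test 1 x \<partial>M k) = (\<integral>x. g x \<partial>M k)" for k
    using I[OF g] I[OF c1] by simp
  ultimately show ?thesis by simp
qed

section \<open>Convergence of the rescaled branching mechanisms\<close>

theorem proposition6p3:
  fixes \<pi> :: "nat \<Rightarrow> nat pmf" and h \<tau> :: "nat \<Rightarrow> real"
  assumes mean: "\<And>k. (\<lambda>j. real j * pmf (\<pi> k) j) sums 1"
    and h_pos: "\<And>k. h k > 0" and h_lim: "h \<longlonglongrightarrow> 0"
    and tau_pos: "\<And>k. \<tau> k > 0" and tau_lim: "\<tau> \<longlonglongrightarrow> 0"
  shows
    "(\<forall>\<kappa>. finite_measure \<kappa> \<and> sets \<kappa> = sets borel \<and> Levy_converges (\<lambda>k. mu_breve (\<pi> k) (h k) (\<tau> k)) \<kappa> \<longrightarrow>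
        (\<exists>!(\<alpha>\<^sub>0, \<alpha>\<^sub>i\<^sub>n\<^sub>f, \<mu>). Levy_triple_of \<kappa> \<alpha>\<^sub>0 \<alpha>\<^sub>i\<^sub>n\<^sub>f \<mu>) \<and>
        (\<forall>\<alpha>\<^sub>0 \<alpha>\<^sub>i\<^sub>n\<^sub>f \<mu>. Levy_triple_of \<kappa> \<alpha>\<^sub>0 \<alpha>\<^sub>i\<^sub>n\<^sub>f \<mu> \<longrightarrow>
           (\<forall>q\<ge>0. (\<lambda>k. Psi_breve (\<pi> k) (h k) (\<tau> k) q) \<longlonglongrightarrow> Levy_Psi \<alpha>\<^sub>0 \<alpha>\<^sub>i\<^sub>n\<^sub>f \<mu> q) \<and>
           (\<forall>m\<ge>1.
              (\<forall>k. times_differentiable_on m (Psi_breve (\<pi> k) (h k) (\<tau> k)) {0<..<2 / h k}) \<and>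
              times_differentiable_on m (Levy_Psi \<alpha>\<^sub>0 \<alpha>\<^sub>i\<^sub>n\<^sub>f \<mu>) {0<..} \<and>
              (\<forall>K. compact K \<and> K \<subseteq> {0<..} \<longrightarrow>
                 uniform_limit K (\<lambda>k. (deriv ^^ m) (Psi_breve (\<pi> k) (h k) (\<tau> k)))
                   ((deriv ^^ m) (Levy_Psi \<alpha>\<^sub>0 \<alpha>\<^sub>i\<^sub>n\<^sub>f \<mu>)) sequentially))))
     \<and>
     (\<forall>\<Psi>. (\<forall>q\<ge>0. (\<lambda>k. Psi_breve (\<pi> k) (h k) (\<tau> k) q) \<longlonglongrightarrow> \<Psi> q) \<longrightarrow>
        (\<exists>\<kappa>. finite_measure \<kappa> \<and> sets \<kappa> = sets borel \<and> Levy_converges (\<lambda>k. mu_breve (\<pi> k) (h k) (\<tau> k)) \<kappa> \<and>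
           (\<exists>!(\<alpha>\<^sub>0, \<alpha>\<^sub>i\<^sub>n\<^sub>f, \<mu>). Levy_triple_of \<kappa> \<alpha>\<^sub>0 \<alpha>\<^sub>i\<^sub>n\<^sub>f \<mu>) \<and>
           (\<forall>\<alpha>\<^sub>0 \<alpha>\<^sub>i\<^sub>n\<^sub>f \<mu>. Levy_triple_of \<kappa> \<alpha>\<^sub>0 \<alpha>\<^sub>i\<^sub>n\<^sub>f \<mu> \<longrightarrow>
              (\<forall>q\<ge>0. \<Psi> q = Levy_Psi \<alpha>\<^sub>0 \<alpha>\<^sub>i\<^sub>n\<^sub>f \<mu> q))))"
proof -
  define \<Phi> where "\<Phi> k = Psi_breve (\<pi> k) (h k) (\<tau> k)" for k
  define T where "T k = truncated_measure (mu_breve (\<pi> k) (h k) (\<tau> k))" for k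
  have Tsets: "sets (T k) = sets borel" for k by (simp add: T_def)
  have Tspace: "space (T k) = UNIV" for k using sets_eq_imp_space_eq[OF Tsets] by simp
  have Tfin: "finite_measure (T k)" for k
  proof -
    have "integrable (T k) (\<lambda>_. 1 :: real)"
      unfolding T_def by (rule truncated_mu_breve_integral(3)[OF mean h_pos tau_pos]) simp
    then have "(\<integral>\<^sup>+x. 1 \<partial>T k) < \<infinity>"
      by (simp add: integrable_iff_bounded)
    then show ?thesis by (intro finite_measureI) (simp add: Tspace)
  qed
  note TI = integrable_continuous_ennreal[OF Tfin Tsets]
  have mass_eq: "(\<integral>x. 1 \<partial>T k) = measure (T k) UNIV" for k
    by (simp add: Tspace)
  have h_right: "filterlim h (at_right 0) sequentially"
    using h_lim h_pos h_pos[THEN less_imp_neq, symmetric] by (auto simp: filterlim_at)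
  have close: "\<forall>\<^sub>F k in sequentially. \<bar>\<Phi> k q - (\<integral>x. levy_test q x \<partial>T k)\<bar> \<le> e * measure (T k) UNIV"
    if "q > 0" "e > 0" for q e
    using filterlim_iff[THEN iffD1, OF h_right, rule_format, OF Psi_breve_close[OF that]]
    by eventually_elim (use mean tau_pos in \<open>simp add: \<Phi>_def T_def flip: mass_eq[unfolded T_def]\<close>)
  have test_0: "\<Phi> k 0 = 0" "levy_test 0 x = 0" for k x
    by (auto simp: \<Phi>_def Psi_breve_def Psi_hat_def levy_test_def extend_ennreal_def levy_kernel_def)

  have diff: "(\<lambda>k. \<Phi> k q - (\<integral>x. levy_test q x \<partial>T k)) \<longlonglongrightarrow> 0"
    if q: "q \<ge> 0" and C: "\<forall>\<^sub>F k in sequentially. measure (T k) UNIV \<le> C" for q C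
  proof (cases "q = 0")
    case False
    show ?thesis
    proof (rule tendstoI)
      fix e :: real assume e: "e > 0"
      define e' where "e' = e / (2 * (\<bar>C\<bar> + 1))"
      have e': "e' > 0" "e' * \<bar>C\<bar> < e"
        using e by (auto simp: e'_def field_simps intro: add_nonneg_pos)
      have "q > 0" using q False by simp
      from close[OF this e'(1)] C
      show "\<forall>\<^sub>F k in sequentially. dist (\<Phi> k q - (\<integral>x. levy_test q x \<partial>T k)) 0 < e"
      proof eventually_elim
        case (elim k)
        have "e' * measure (T k) UNIV \<le> e' * \<bar>C\<bar>"
          using elim e' by (intro mult_left_mono) auto
        then have "\<bar>\<Phi> k q - (\<integral>x. levy_test q x \<partial>T k)\<bar> < e"
          using elim(1) e'(2) by linarith
        then show ?case by (simp add: dist_real_def)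
      qed
    qed
  qed (simp add: test_0)

  \<comment> \<open>Levy convergence tested with the constant function bounds the masses.\<close>
  have part1: "(\<lambda>k. \<Phi> k q) \<longlonglongrightarrow> Levy_Psi a b \<mu> q"
    if k: "finite_measure \<kappa>" "sets \<kappa> = sets borel" and conv: "weak_star_conv T \<kappa>"
      and t: "Levy_triple_of \<kappa> a b \<mu>" and q: "q \<ge> 0" for \<kappa> a b \<mu> q
  proof -
    have W: "(\<lambda>k. \<integral>x. g x \<partial>T k) \<longlonglongrightarrow> (\<integral>x. g x \<partial>\<kappa>)" if "continuous_on UNIV g" for g :: "ennreal \<Rightarrow> real"
      using conv that by (auto simp: weak_star_conv_def)
    have "(\<lambda>k. measure (T k) UNIV) \<longlonglongrightarrow> (\<integral>x. 1 \<partial>\<kappa>)"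
      using W[of "\<lambda>_. 1"] unfolding mass_eq by simp
    then have "\<forall>\<^sub>F k in sequentially. measure (T k) UNIV < (\<integral>x. 1 \<partial>\<kappa>) + 1"
      by (rule order_tendstoD) simp
    then have "\<forall>\<^sub>F k in sequentially. measure (T k) UNIV \<le> (\<integral>x. 1 \<partial>\<kappa>) + 1"
      by eventually_elim simp
    from tendsto_add[OF diff[OF q this] W[OF continuous_on_levy_test[OF q]]]
    show ?thesis by (simp add: integral_levy_test[OF k t q])
  qed

  have smooth_Psi_breve: "times_differentiable_on m (\<Phi> k) {0<..<2 / h k}"
    "\<And>q. q \<in> {0<..<2 / h k} \<Longrightarrow> (deriv ^^ m) (\<Phi> k) q = Psi_breve_deriv (\<pi> k) (h k) (\<tau> k) m q" for m k
  proof -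
    let ?S = "{0<..<2 / h k}" and ?F = "Psi_breve_deriv (\<pi> k) (h k) (\<tau> k)"
    have f: "\<Phi> k q = ?F 0 q" if "q \<in> ?S" for q
      unfolding \<Phi>_def by (rule Psi_breve_deriv_0[OF mean h_pos that])
    have F: "(?F m has_real_derivative ?F (Suc m) q) (at q)" if "q \<in> ?S" for m q
      by (rule Psi_breve_deriv_has_derivative[OF h_pos tau_pos that])
    note smooth = iterated_deriv[where S = ?S and f = "\<Phi> k" and F = ?F, OF open_greaterThanLessThan f F]
    show "times_differentiable_on m (\<Phi> k) {0<..<2 / h k}"
      "\<And>q. q \<in> {0<..<2 / h k} \<Longrightarrow> (deriv ^^ m) (\<Phi> k) q = Psi_breve_deriv (\<pi> k) (h k) (\<tau> k) m q"
      using smooth by auto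
  qed

  have large: "\<forall>\<^sub>F k in sequentially. B < 1 / h k" for B
  proof -
    have "filterlim (\<lambda>k. inverse (h k)) at_top sequentially"
      by (rule filterlim_compose[OF filterlim_inverse_at_top_right h_right])
    then show ?thesis by (simp add: filterlim_at_top_dense inverse_eq_divide)
  qed

  have part1_deriv: "times_differentiable_on m (Levy_Psi a b \<mu>) {0<..} \<and>
      (\<forall>K. compact K \<and> K \<subseteq> {0<..} \<longrightarrow>
        uniform_limit K (\<lambda>k. (deriv ^^ m) (\<Phi> k)) ((deriv ^^ m) (Levy_Psi a b \<mu>)) sequentially)"
    if k: "finite_measure \<kappa>" "sets \<kappa> = sets borel" and conv: "weak_star_conv T \<kappa>"
      and t: "Levy_triple_of \<kappa> a b \<mu>" and m: "m \<ge> 1" for \<kappa> a b \<mu> m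
  proof -
    note facts = triple_facts[OF k t]
    have min: "integrable \<mu> (\<lambda>x. min x 1)"
      using triple_integral(2)[OF k t continuous_on_const[of UNIV 1]]
        truncated_measure_integral(2)[OF facts(3), of "\<lambda>_. 1"] by simp
    note G = Levy_Psi_deriv_has_derivative[OF facts(3) min levy_kernel_integrable[OF k t], of _ a b]
    have "(Levy_Psi_deriv a b \<mu> m has_real_derivative Levy_Psi_deriv a b \<mu> (Suc m) q) (at q)"
      if "q \<in> {0<..}" for m q using G that by auto
    note smooth = iterated_deriv[where S = "{0<..}" and f = "Levy_Psi a b \<mu>" and F = "Levy_Psi_deriv a b \<mu>",
        OF open_greaterThan fun_cong[OF Levy_Psi_deriv_0] this]
    have L: "times_differentiable_on m (Levy_Psi a b \<mu>) {0<..}"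
      "\<And>q. q \<in> {0<..} \<Longrightarrow> (deriv ^^ m) (Levy_Psi a b \<mu>) q = Levy_Psi_deriv a b \<mu> m q"
      using smooth by auto
    obtain n where n: "m = Suc n" using m by (cases m) auto
    let ?F = "\<lambda>k. Psi_breve_deriv (\<pi> k) (h k) (\<tau> k)"
    \<comment> \<open>Smoothness holds on \<open>(0, 2 / h)\<close>, the sign pattern only on \<open>(0, 1 / h)\<close>.\<close>
    have two: "1 / h k < 2 / h k" for k using h_pos[of k] by (simp add: divide_strict_right_mono)
    have "uniform_limit K (\<lambda>k. (deriv ^^ m) (\<Phi> k)) ((deriv ^^ m) (Levy_Psi a b \<mu>)) sequentially"
      if K: "compact K" "K \<subseteq> {0<..}" for K
    proof -
      obtain B where B: "\<And>x. x \<in> K \<Longrightarrow> x < B"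
        using compact_imp_bounded[OF K(1)] unfolding bounded_iff
        by (metis abs_le_D1 gt_ex le_less_trans real_norm_def)
      have "uniform_limit K (\<lambda>k. ?F k (Suc n)) (Levy_Psi_deriv a b \<mu> (Suc n)) sequentially"
      proof (rule derivatives_converge(2)[OF _ _ _ _ K])
        show "\<forall>\<^sub>F k in sequentially. \<forall>m. \<forall>q\<in>{0<..<B}. (?F k m has_real_derivative ?F k (Suc m) q) (at q)" for B
          using large[of B]
        proof eventually_elim
          case (elim k)
          then show ?case
            using two[of k] by (auto intro!: Psi_breve_deriv_has_derivative h_pos tau_pos)
        qed
        show "\<forall>\<^sub>F k in sequentially. \<forall>m\<ge>2. \<forall>q\<in>{0<..<B}. 0 \<le> (- 1) ^ m * ?F k m q" for B
          using large[of B]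
          by eventually_elim (auto intro!: Psi_breve_deriv_sign h_pos tau_pos)
        show "(Levy_Psi_deriv a b \<mu> m has_real_derivative Levy_Psi_deriv a b \<mu> (Suc m) q) (at q)"
          if "q > 0" for m q using G that by blast
        show "(\<lambda>k. ?F k 0 q) \<longlonglongrightarrow> Levy_Psi_deriv a b \<mu> 0 q" if "q > 0" for q
        proof (rule Lim_transform_eventually)
          show "(\<lambda>k. \<Phi> k q) \<longlonglongrightarrow> Levy_Psi_deriv a b \<mu> 0 q"
            using part1[OF k conv t, of q] that by (simp add: Levy_Psi_deriv_0)
          show "\<forall>\<^sub>F k in sequentially. \<Phi> k q = ?F k 0 q"
            using large[of q]
            by eventually_elim (use smooth_Psi_breve(2)[of q _ 0] two that in fastforce)
        qed
      qed
      moreover have "\<forall>\<^sub>F k in sequentially. \<forall>x\<in>K. (deriv ^^ m) (\<Phi> k) x = ?F k (Suc n) x"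
        using large[of B]
      proof eventually_elim
        case (elim k)
        have "x \<in> {0<..<2 / h k}" if "x \<in> K" for x
          using that B[OF that] K(2) elim two[of k] by auto
        then show ?case using smooth_Psi_breve(2) n by blast
      qed
      ultimately show ?thesis
        using L(2) K(2) n by (subst uniform_limit_cong) auto
    qed
    with L(1) show ?thesis by blast
  qed

  have part2: "\<exists>\<kappa>. finite_measure \<kappa> \<and> sets \<kappa> = sets borel \<and> weak_star_conv T \<kappa>"
    if lim: "\<forall>q\<ge>0. (\<lambda>k. \<Phi> k q) \<longlonglongrightarrow> \<Psi> q" for \<Psi>
  proof -
    have c1: "continuous_on UNIV (levy_test 1)" by (intro continuous_on_levy_test) simp
    obtain y where y: "\<And>x. levy_test 1 y \<le> levy_test 1 x"
      using continuous_attains_inf[OF compact_UNIV_ennreal _ c1] by auto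
    define c where "c = levy_test 1 y"
    have c: "c > 0" by (simp add: c_def levy_test_pos)
    \<comment> \<open>On a compact space the positive function \<open>levy_test 1\<close> is at least some \<open>c > 0\<close>, so
      the values at \<open>q = 1\<close> control the masses.\<close>
    have ge: "c * measure (T k) UNIV \<le> (\<integral>x. levy_test 1 x \<partial>T k)" for k
    proof -
      have "(\<integral>x. c \<partial>T k) \<le> (\<integral>x. levy_test 1 x \<partial>T k)"
        using y TI[OF c1] TI[of "\<lambda>_. c"] by (intro integral_mono) (auto simp: c_def)
      then show ?thesis by (simp add: Tspace mult.commute)
    qed
    have "\<forall>\<^sub>F k in sequentially. \<Phi> k 1 < \<Psi> 1 + 1"
      using lim by (intro order_tendstoD(2)[of _ "\<Psi> 1"]) auto
    moreover have "\<forall>\<^sub>F k in sequentially. \<bar>\<Phi> k 1 - (\<integral>x. levy_test 1 x \<partial>T k)\<bar> \<le> c / 2 * measure (T k) UNIV"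
      using c by (intro close) auto
    ultimately have C: "\<forall>\<^sub>F k in sequentially. measure (T k) UNIV \<le> (\<Psi> 1 + 1) / (c / 2)"
    proof eventually_elim
      case (elim k)
      have "c / 2 * measure (T k) UNIV \<le> \<Psi> 1 + 1" using elim ge[of k] by linarith
      then show ?case using c by (simp add: field_simps)
    qed
    have tests: "convergent (\<lambda>k. \<integral>x. levy_test q x \<partial>T k)" if "q \<ge> 0" for q
    proof -
      have "(\<lambda>k. \<Phi> k q - (\<Phi> k q - (\<integral>x. levy_test q x \<partial>T k))) \<longlonglongrightarrow> \<Psi> q - 0"
        using lim that by (intro tendsto_diff diff[OF that C]) auto
      then show ?thesis by (auto simp: convergent_def)
    qed
    show ?thesis
    proof (rule weak_star_limit_exists[OF Tfin Tsets])
      show "convergent (\<lambda>k. \<integral>x. g x \<partial>T k)" if g: "continuous_on UNIV g" for g :: "ennreal \<Rightarrow> real"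
        by (rule levy_tests_determine_limit[OF Tfin Tsets C tests g])
    qed
  qed

  have LC: "Levy_converges (\<lambda>k. mu_breve (\<pi> k) (h k) (\<tau> k)) \<kappa> \<longleftrightarrow> weak_star_conv T \<kappa>" for \<kappa>
    by (simp add: Levy_converges_def T_def[abs_def])
  show ?thesis
    unfolding LC \<Phi>_def[symmetric]
  proof (intro conjI allI impI)
    fix \<kappa> assume *: "finite_measure \<kappa> \<and> sets \<kappa> = sets borel \<and> weak_star_conv T \<kappa>"
    then show "\<exists>!(a, b, \<mu>). Levy_triple_of \<kappa> a b \<mu>" by (intro ex1_Levy_triple_of) auto
    fix a b \<mu> assume t: "Levy_triple_of \<kappa> a b \<mu>"
    show "(\<lambda>k. \<Phi> k q) \<longlonglongrightarrow> Levy_Psi a b \<mu> q" if "q \<ge> 0" for q using part1 * t that by blast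
    show "times_differentiable_on m (\<Phi> k) {0<..<2 / h k}" for m k by (rule smooth_Psi_breve)
    show "times_differentiable_on m (Levy_Psi a b \<mu>) {0<..}" if "m \<ge> 1" for m
      using part1_deriv * t that by blast
    show "uniform_limit K (\<lambda>k. (deriv ^^ m) (\<Phi> k)) ((deriv ^^ m) (Levy_Psi a b \<mu>)) sequentially"
      if "m \<ge> 1" "compact K \<and> K \<subseteq> {0<..}" for m K
      using part1_deriv * t that by blast
  next
    fix \<Psi> assume lim: "\<forall>q\<ge>0. (\<lambda>k. \<Phi> k q) \<longlonglongrightarrow> \<Psi> q"
    obtain \<kappa> where k: "finite_measure \<kappa>" "sets \<kappa> = sets borel" "weak_star_conv T \<kappa>"
      using part2[OF lim] by blast
    show "\<exists>\<kappa>. finite_measure \<kappa> \<and> sets \<kappa> = sets borel \<and> weak_star_conv T \<kappa> \<and>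
           (\<exists>!(a, b, \<mu>). Levy_triple_of \<kappa> a b \<mu>) \<and>
           (\<forall>a b \<mu>. Levy_triple_of \<kappa> a b \<mu> \<longrightarrow> (\<forall>q\<ge>0. \<Psi> q = Levy_Psi a b \<mu> q))"
    proof (intro exI[of _ \<kappa>] conjI allI impI k ex1_Levy_triple_of)
      fix a b \<mu> and q :: real assume "Levy_triple_of \<kappa> a b \<mu>" "q \<ge> 0"
      then show "\<Psi> q = Levy_Psi a b \<mu> q"
        using part1[OF k] lim LIMSEQ_unique by blast
    qed
  qed
qed

end
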